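(* The assignment $\mathsf{Mealy}$, sending an object $\left(\binom{X_{\rm in}}{X_{\rm out}}, d_X\right)$ of $\mathsf{dDWD}$ to the set $\mathsf{Mealy}\left(\binom{X_{\rm in}}{X_{\rm out}}, d_X\right)$ of Mealy machines with that interface, and a morphism $f$ to the map $(S,u,r)\mapsto (S,\mathsf{Mealy}(f)(u),\mathsf{Mealy}(f)(r))$, is a lax monoidal functor $$\mathsf{Mealy} : \left(\mathsf{dDWD}, +, \left(\tbinom{0}{0}, !\right)\right) \to (\mathsf{Set}, \times, 1),$$ with structure maps given by juxtaposition of Mealy machines.
   Context: **Maps induced by functions and spans.** For a finite set $A$, an element of $\mathbb{R}^A$ is a function $A\to\mathbb{R}$. For $f:A\to B$ a map of finite sets, $f^*:\mathbb{R}^B\to\mathbb{R}^A$ is $f^*(x)=x\circ f$ and $f_*:\mathbb{R}^A\to\mathbb{R}^B$ is $f_*(x)(b)=\sum_{a\in f^{-1}(b)}x(a)$. For a span of finite sets $A\xleftarrow{s}R\xrightarrow{t}B$ write $R^*:=t_*\circ s^*:\mathbb{R}^A\to\mathbb{R}^B$. A function $\phi:\mathbb{R}^A\to\mathbb{R}^B$ respects the span (or relation) $A\xleftarrow{s}R\xrightarrow{t}B$ if for every $b\in B$ and $x\in\mathbb{R}^A$, the value $\phi(x)(b)$ depends only on the restriction of $x$ to $s(t^{-1}(b))\subseteq A$. **Directed wiring diagrams.** $\mathsf{DWD}$ is the symmetric monoidal category whose objects are pairs $\binom{X_{\rm in}}{X_{\rm out}}$ of finite sets (input ports, output ports), and whose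 morphisms $f:\binom{X_{\rm in}}{X_{\rm out}}\to\binom{Y_{\rm in}}{Y_{\rm out}}$ are triples of spans of finite sets $$Y_{\rm in}\xleftarrow{s}f(W_{\rm in})\xrightarrow{t}X_{\rm in},\qquad X_{\rm out}\xleftarrow{s}f(W)\xrightarrow{t}X_{\rm in},\qquad X_{\rm out}\xleftarrow{s}f(W_{\rm out})\xrightarrow{t}Y_{\rm out},$$ considered up to isomorphism of spans (input, trace and output wires). The composite of $f$ with $g:\binom{Y_{\rm in}}{Y_{\rm out}}\to\binom{Z_{\rm in}}{Z_{\rm out}}$ is $(g\circ f)(W_{\rm in})=g(W_{\rm in})\times_{Y_{\rm in}}f(W_{\rm in})$, $(g\circ f)(W)=f(W)+f(W_{\rm out})\times_{Y_{\rm out}}g(W)\times_{Y_{\rm in}}f(W_{\rm in})$, $(g\circ f)(W_{\rm out})=g(W_{\rm out})\times_{Y_{\rm out}}f(W_{\rm out})$, with the evident source and target maps. The identity has $W_{\rm in}=X_{\rm in}$, $W=\emptyset$, $W_{\rm out}=X_{\rm out}$. The monoidal product $+$ is disjoint union of ports and of wires, with unit $\binom{0}{0}$. **Dependencies.** A dependency $d_X$ on $\binom{X_{\rm in}}{X_{\rm out}}$ is a relation between $X_{\rm in}$ and $X_{\rm out}$, viewed as a span $X_{\rm in}\xleftarrow{s}d_X\xrightarrow{t}X_{\rm out}$; dependencies are ordered by inclusion. For $f:\binom{X_{\rm in}}{X_{\rm out}}\to\binom{Y_{\rm in}}{Y_{\rm out}}$, put $X=X_{\rm in}+X_{\rm out}$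 and let $f(W)+_Xd_X$ be the directed graph with vertex set $X$ and edge set $f(W)+d_X$ (each element directed from its source to its target). Let $\mathsf{Path}(f(W)+_Xd_X)$ be the set of directed paths in it. $R(f)(d_X)$ is the relation between $Y_{\rm in}$ and $Y_{\rm out}$ that is the image of the span $Y_{\rm in}\leftarrow f(W_{\rm in})\times_X\mathsf{Path}(f(W)+_Xd_X)\times_Xf(W_{\rm out})\to Y_{\rm out}$. **The category $\mathsf{dDWD}$.** Objects are pairs $\left(\binom{X_{\rm in}}{X_{\rm out}},d_X\right)$ with $d_X$ a dependency. Morphisms $\left(\binom{X_{\rm in}}{X_{\rm out}},d_X\right)\to\left(\binom{Y_{\rm in}}{Y_{\rm out}},d_Y\right)$ are morphisms $f$ of $\mathsf{DWD}$ with $R(f)(d_X)\subseteq d_Y$ and such that $f(W)+_Xd_X$ is acyclic. Composition is as in $\mathsf{DWD}$; the monoidal product is $+$ on ports, wires and dependencies (disjoint union), with unit $\left(\binom00,!\right)$, where $!$ is the unique (empty) dependency. **Mealy machines.** $\mathsf{Mealy}\left(\binom{X_{\rm in}}{X_{\rm out}},d_X\right)$ is the set of triples $(S,\ u:\mathbb{R}^{X_{\rm in}}\times\mathbb{R}^S\to\mathbb{R}^S,\ r:\mathbb{R}^{X_{\rm in}}\times\mathbb{R}^S\to\mathbb{R}^{X_{\rm out}})$ where $S$ is a finite set and $r$ respects $d_X$, i.e. for each $x\in\mathbb{R}^S$ the map $r(-,x):\mathbb{R}^{X_{\rm in}}\to\mathbb{R}^{X_{\rm out}}$ respects $d_X$.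 Triples are considered up to bijections of state sets $S\cong S'$ compatible with $u$ and $r$. **Action on morphisms.** Let $f:\left(\binom{X_{\rm in}}{X_{\rm out}},d_X\right)\to\left(\binom{Y_{\rm in}}{Y_{\rm out}},d_Y\right)$ be in $\mathsf{dDWD}$ and $(S,u,r)$ a Mealy machine on the domain. For $a\in\mathbb{R}^{X_{\rm in}}$, $x\in\mathbb{R}^S$, the endomorphism of $\mathbb{R}^{X_{\rm in}}\times\mathbb{R}^{X_{\rm out}}$ given by $(x_{\rm in},x_{\rm out})\mapsto(f(W)^*(x_{\rm out})+a,\ r(x_{\rm in},x))$ has a unique fixed point because $f$ is acyclic; denote it $(\overline{\phi}^{f,r}_{\rm in}(a,x),\overline{\phi}^{f,r}_{\rm out}(a,x))$. For $y\in\mathbb{R}^{Y_{\rm in}}$ define $$\mathsf{Mealy}(f)(u)(y,x)=u\big(\overline{\phi}^{f,r}_{\rm in}(f(W_{\rm in})^*(y),x),\,x\big),\qquad \mathsf{Mealy}(f)(r)(y,x)=f(W_{\rm out})^*\big(\overline{\phi}^{f,r}_{\rm out}(f(W_{\rm in})^*(y),x)\big).$$ **Structure maps.** The laxator sends $((S,u,r),(S',u',r'))$ to $(S+S',u\times u',r\times r')$ (using $\mathbb{R}^{A+B}\cong\mathbb{R}^A\times\mathbb{R}^B$), and the unit map picks out the Mealy machine with $S=\emptyset$ on $\left(\binom00,!\right)$. *)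

theory Defs
  imports Complex_Main "HOL-Library.FuncSet" "Graph_Theory.Arc_Walk"
begin

section \<open>Monoidal categories and lax monoidal functors to sets\<close>

record ('o, 'm) moncat =
  Ob :: "'o set"
  Ar :: "'m set"
  Dom :: "'m \<Rightarrow> 'o"
  Cod :: "'m \<Rightarrow> 'o"
  Idt :: "'o \<Rightarrow> 'm"
  Comp :: "'m \<Rightarrow> 'm \<Rightarrow> 'm"
  TenO :: "'o \<Rightarrow> 'o \<Rightarrow> 'o"
  TenA :: "'m \<Rightarrow> 'm \<Rightarrow> 'm"
  Unit :: "'o"
  Assoc :: "'o \<Rightarrow> 'o \<Rightarrow> 'o \<Rightarrow> 'm"
  Lunit :: "'o \<Rightarrow> 'm"
  Runit :: "'o \<Rightarrow> 'm"

definition Hom :: "('o, 'm) moncat \<Rightarrow> 'o \<Rightarrow> 'o \<Rightarrow> 'm set" where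
  "Hom C X Y = {f \<in> Ar C. Dom C f = X \<and> Cod C f = Y}"

text \<open>\<open>Comp C g f\<close> is the composite \<open>g \<circ> f\<close>, meaningful when \<open>Cod C f = Dom C g\<close>.\<close>

locale category =
  fixes C :: "('o, 'm) moncat"
  assumes Dom_Ob: "f \<in> Ar C \<Longrightarrow> Dom C f \<in> Ob C"
    and Cod_Ob: "f \<in> Ar C \<Longrightarrow> Cod C f \<in> Ob C"
    and Idt_Hom: "X \<in> Ob C \<Longrightarrow> Idt C X \<in> Hom C X X"
    and Comp_Hom: "f \<in> Hom C X Y \<Longrightarrow> g \<in> Hom C Y Z \<Longrightarrow> Comp C g f \<in> Hom C X Z"
    and Comp_Idt_left: "f \<in> Hom C X Y \<Longrightarrow> Comp C (Idt C Y) f = f"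
    and Comp_Idt_right: "f \<in> Hom C X Y \<Longrightarrow> Comp C f (Idt C X) = f"
    and Comp_assoc: "f \<in> Hom C W X \<Longrightarrow> g \<in> Hom C X Y \<Longrightarrow> h \<in> Hom C Y Z \<Longrightarrow>
      Comp C h (Comp C g f) = Comp C (Comp C h g) f"

definition iso_Hom :: "('o, 'm) moncat \<Rightarrow> 'o \<Rightarrow> 'o \<Rightarrow> 'm set" where
  "iso_Hom C X Y = {f \<in> Hom C X Y. \<exists>g \<in> Hom C Y X. Comp C g f = Idt C X \<and> Comp C f g = Idt C Y}"

locale monoidal_category = category C for C :: "('o, 'm) moncat" +
  assumes TenO_Ob: "X \<in> Ob C \<Longrightarrow> Y \<in> Ob C \<Longrightarrow> TenO C X Y \<in> Ob C"
    and Unit_Ob: "Unit C \<in> Ob C"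
    and TenA_Hom: "f \<in> Hom C X X' \<Longrightarrow> g \<in> Hom C Y Y' \<Longrightarrow>
      TenA C f g \<in> Hom C (TenO C X Y) (TenO C X' Y')"
    and TenA_Idt: "X \<in> Ob C \<Longrightarrow> Y \<in> Ob C \<Longrightarrow>
      TenA C (Idt C X) (Idt C Y) = Idt C (TenO C X Y)"
    and TenA_Comp: "f \<in> Hom C X X' \<Longrightarrow> f' \<in> Hom C X' X'' \<Longrightarrow>
      g \<in> Hom C Y Y' \<Longrightarrow> g' \<in> Hom C Y' Y'' \<Longrightarrow>
      TenA C (Comp C f' f) (Comp C g' g) = Comp C (TenA C f' g') (TenA C f g)"
    and Assoc_iso: "X \<in> Ob C \<Longrightarrow> Y \<in> Ob C \<Longrightarrow> Z \<in> Ob C \<Longrightarrow>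
      Assoc C X Y Z \<in> iso_Hom C (TenO C (TenO C X Y) Z) (TenO C X (TenO C Y Z))"
    and Lunit_iso: "X \<in> Ob C \<Longrightarrow> Lunit C X \<in> iso_Hom C (TenO C (Unit C) X) X"
    and Runit_iso: "X \<in> Ob C \<Longrightarrow> Runit C X \<in> iso_Hom C (TenO C X (Unit C)) X"
    and Assoc_nat: "f \<in> Hom C X X' \<Longrightarrow> g \<in> Hom C Y Y' \<Longrightarrow> h \<in> Hom C Z Z' \<Longrightarrow>
      Comp C (Assoc C X' Y' Z') (TenA C (TenA C f g) h)
        = Comp C (TenA C f (TenA C g h)) (Assoc C X Y Z)"
    and Lunit_nat: "f \<in> Hom C X X' \<Longrightarrow>
      Comp C (Lunit C X') (TenA C (Idt C (Unit C)) f) = Comp C f (Lunit C X)"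
    and Runit_nat: "f \<in> Hom C X X' \<Longrightarrow>
      Comp C (Runit C X') (TenA C f (Idt C (Unit C))) = Comp C f (Runit C X)"
    and pentagon: "W \<in> Ob C \<Longrightarrow> X \<in> Ob C \<Longrightarrow> Y \<in> Ob C \<Longrightarrow> Z \<in> Ob C \<Longrightarrow>
      Comp C (Assoc C W X (TenO C Y Z)) (Assoc C (TenO C W X) Y Z)
        = Comp C (TenA C (Idt C W) (Assoc C X Y Z))
            (Comp C (Assoc C W (TenO C X Y) Z) (TenA C (Assoc C W X Y) (Idt C Z)))"
    and triangle: "X \<in> Ob C \<Longrightarrow> Y \<in> Ob C \<Longrightarrow>
      Comp C (TenA C (Idt C X) (Lunit C Y)) (Assoc C X (Unit C) Y)
        = TenA C (Runit C X) (Idt C Y)"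

text \<open>
  A lax monoidal functor \<open>F\<close> from \<open>C\<close> to \<open>(Set, \<times>, 1)\<close>. The target is represented by HOL sets,
  functions on these sets, cartesian products \<open>\<times>\<close> and the one-point set \<open>{()}\<close>; the associator
  and unitors of the target are the bijections \<open>((a, b), c) \<mapsto> (a, (b, c))\<close>, \<open>((), a) \<mapsto> a\<close> and
  \<open>(a, ()) \<mapsto> a\<close>, which have been inserted in the three coherence axioms. Equations between
  functions are required on their domain.
\<close>

locale lax_monoidal_functor_to_Set = monoidal_category C for C :: "('o, 'm) moncat" +
  fixes F :: "'o \<Rightarrow> 'e set"
    and F_map :: "'m \<Rightarrow> 'e \<Rightarrow> 'e"
    and laxator :: "'o \<Rightarrow> 'o \<Rightarrow> 'e \<times> 'e \<Rightarrow> 'e"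
    and unit_map :: "unit \<Rightarrow> 'e"
  assumes F_map_fun: "f \<in> Hom C X Y \<Longrightarrow> F_map f \<in> F X \<rightarrow> F Y"
    and F_map_Idt: "X \<in> Ob C \<Longrightarrow> a \<in> F X \<Longrightarrow> F_map (Idt C X) a = a"
    and F_map_Comp: "f \<in> Hom C X Y \<Longrightarrow> g \<in> Hom C Y Z \<Longrightarrow> a \<in> F X \<Longrightarrow>
      F_map (Comp C g f) a = F_map g (F_map f a)"
    and laxator_fun: "X \<in> Ob C \<Longrightarrow> Y \<in> Ob C \<Longrightarrow> laxator X Y \<in> F X \<times> F Y \<rightarrow> F (TenO C X Y)"
    and laxator_nat: "f \<in> Hom C X X' \<Longrightarrow> g \<in> Hom C Y Y' \<Longrightarrow> a \<in> F X \<Longrightarrow> b \<in> F Y \<Longrightarrow>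
      F_map (TenA C f g) (laxator X Y (a, b)) = laxator X' Y' (F_map f a, F_map g b)"
    and unit_map_fun: "unit_map \<in> {()} \<rightarrow> F (Unit C)"
    and lax_assoc: "X \<in> Ob C \<Longrightarrow> Y \<in> Ob C \<Longrightarrow> Z \<in> Ob C \<Longrightarrow>
      a \<in> F X \<Longrightarrow> b \<in> F Y \<Longrightarrow> c \<in> F Z \<Longrightarrow>
      F_map (Assoc C X Y Z) (laxator (TenO C X Y) Z (laxator X Y (a, b), c))
        = laxator X (TenO C Y Z) (a, laxator Y Z (b, c))"
    and lax_Lunit: "X \<in> Ob C \<Longrightarrow> a \<in> F X \<Longrightarrow>
      F_map (Lunit C X) (laxator (Unit C) X (unit_map (), a)) = a"
    and lax_Runit: "X \<in> Ob C \<Longrightarrow> a \<in> F X \<Longrightarrow>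
      F_map (Runit C X) (laxator X (Unit C) (a, unit_map ())) = a"

section \<open>Finite sets, spans, and the maps they induce\<close>

text \<open>
  Finite sets are finite subsets of a universe that contains an arbitrary type of atoms and is
  closed under disjoint unions and pairs (the latter for fibre products). It is always infinite.
\<close>

datatype 'a univ = Atom 'a | InL "'a univ" | InR "'a univ" | Pr "'a univ" "'a univ"

primrec prfst :: "'a univ \<Rightarrow> 'a univ" where
  "prfst (Pr x y) = x"

primrec prsnd :: "'a univ \<Rightarrow> 'a univ" where
  "prsnd (Pr x y) = y"

primrec copair :: "('a univ \<Rightarrow> 'b) \<Rightarrow> ('a univ \<Rightarrow> 'b) \<Rightarrow> 'a univ \<Rightarrow> 'b" where
  "copair f g (InL x) = f x"
| "copair f g (InR x) = g x"

definition dunion :: "'a univ set \<Rightarrow> 'a univ set \<Rightarrow> 'a univ set" where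
  "dunion A B = InL ` A \<union> InR ` B"

text \<open>\<open>RR A\<close> is the set of real-valued functions on \<open>A\<close>, as extensional HOL functions.\<close>

definition RR :: "'p set \<Rightarrow> ('p \<Rightarrow> real) set" where
  "RR A = (A \<rightarrow>\<^sub>E UNIV)"

definition pull :: "'p set \<Rightarrow> ('p \<Rightarrow> 'q) \<Rightarrow> ('q \<Rightarrow> real) \<Rightarrow> 'p \<Rightarrow> real" where
  "pull A f x = (\<lambda>a\<in>A. x (f a))"

definition push :: "'p set \<Rightarrow> ('p \<Rightarrow> 'q) \<Rightarrow> 'q set \<Rightarrow> ('p \<Rightarrow> real) \<Rightarrow> 'q \<Rightarrow> real" where
  "push A f B x = (\<lambda>b\<in>B. \<Sum>a\<in>{a \<in> A. f a = b}. x a)"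

definition vadd :: "'p set \<Rightarrow> ('p \<Rightarrow> real) \<Rightarrow> ('p \<Rightarrow> real) \<Rightarrow> 'p \<Rightarrow> real" where
  "vadd A x y = (\<lambda>i\<in>A. x i + y i)"

record ('w, 'p, 'q) span =
  apex :: "'w set"
  src :: "'w \<Rightarrow> 'p"
  tgt :: "'w \<Rightarrow> 'q"

definition is_span :: "'p set \<Rightarrow> 'q set \<Rightarrow> ('w, 'p, 'q) span \<Rightarrow> bool" where
  "is_span A B R \<longleftrightarrow> finite (apex R) \<and> src R \<in> apex R \<rightarrow> A \<and> tgt R \<in> apex R \<rightarrow> B"

definition span_iso :: "('w, 'p, 'q) span \<Rightarrow> ('w, 'p, 'q) span \<Rightarrow> bool" where
  "span_iso R Q \<longleftrightarrow> (\<exists>h. bij_betw h (apex R) (apex Q) \<and>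
     (\<forall>w\<in>apex R. src Q (h w) = src R w \<and> tgt Q (h w) = tgt R w))"

text \<open>The map \<open>R\<^sup>*\<close> induced by a span \<open>R\<close> with right foot \<open>B\<close>.\<close>

definition span_map :: "'q set \<Rightarrow> ('w, 'p, 'q) span \<Rightarrow> ('p \<Rightarrow> real) \<Rightarrow> 'q \<Rightarrow> real" where
  "span_map B R x = push (apex R) (tgt R) B (pull (apex R) (src R) x)"

definition rel_span :: "('p \<times> 'q) set \<Rightarrow> ('p \<times> 'q, 'p, 'q) span" where
  "rel_span d = \<lparr>apex = d, src = fst, tgt = snd\<rparr>"

definition respects_span :: "'p set \<Rightarrow> 'q set \<Rightarrow> ('w, 'p, 'q) span
    \<Rightarrow> (('p \<Rightarrow> real) \<Rightarrow> 'q \<Rightarrow> real) \<Rightarrow> bool" where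
  "respects_span A B R \<phi> \<longleftrightarrow> (\<forall>b\<in>B. \<forall>x\<in>RR A. \<forall>x'\<in>RR A.
     (\<forall>a \<in> src R ` {w \<in> apex R. tgt R w = b}. x a = x' a) \<longrightarrow> \<phi> x b = \<phi> x' b)"

text \<open>Composite by fibre product: from \<open>A \<leftarrow> R \<rightarrow> B\<close> and \<open>B \<leftarrow> Q \<rightarrow> C\<close> to \<open>A \<leftarrow> R \<times>\<^sub>B Q \<rightarrow> C\<close>.\<close>

definition span_comp ::
  "('a univ, 'p, 'q) span \<Rightarrow> ('a univ, 'q, 'r) span \<Rightarrow> ('a univ, 'p, 'r) span" where
  "span_comp R Q =
    \<lparr>apex = {Pr v w | v w. v \<in> apex R \<and> w \<in> apex Q \<and> tgt R v = src Q w},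
     src = src R \<circ> prfst, tgt = tgt Q \<circ> prsnd\<rparr>"

text \<open>Two disjoint unions: of spans with common feet, and of spans along with their feet.\<close>

definition span_add ::
  "('a univ, 'p, 'q) span \<Rightarrow> ('a univ, 'p, 'q) span \<Rightarrow> ('a univ, 'p, 'q) span" where
  "span_add R Q =
    \<lparr>apex = dunion (apex R) (apex Q),
     src = copair (src R) (src Q), tgt = copair (tgt R) (tgt Q)\<rparr>"

definition span_par :: "('a univ, 'a univ, 'a univ) span \<Rightarrow> ('a univ, 'a univ, 'a univ) span
    \<Rightarrow> ('a univ, 'a univ, 'a univ) span" where
  "span_par R Q =
    \<lparr>apex = dunion (apex R) (apex Q),
     src = copair (InL \<circ> src R) (InR \<circ> src Q), tgt = copair (InL \<circ> tgt R) (InR \<circ> tgt Q)\<rparr>"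

section \<open>Directed wiring diagrams\<close>

record 'p iface =
  inp :: "'p set"
  outp :: "'p set"

record 'p diface = "'p iface" +
  dep :: "('p \<times> 'p) set"

record 'a diagram =
  Win :: "('a univ, 'a univ, 'a univ) span"
  Wtr :: "('a univ, 'a univ, 'a univ) span"
  Wout :: "('a univ, 'a univ, 'a univ) span"

definition is_diagram :: "('a univ, 'z) iface_scheme \<Rightarrow> ('a univ, 'z) iface_scheme
    \<Rightarrow> 'a diagram \<Rightarrow> bool" where
  "is_diagram X Y f \<longleftrightarrow>
     is_span (inp Y) (inp X) (Win f) \<and>
     is_span (outp X) (inp X) (Wtr f) \<and>
     is_span (outp X) (outp Y) (Wout f)"

definition diagram_eq :: "('a diagram \<times> 'a diagram) set" where
  "diagram_eq = {(f, g). span_iso (Win f) (Win g) \<and> span_iso (Wtr f) (Wtr g)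
     \<and> span_iso (Wout f) (Wout g)}"

definition diagram_class :: "'a diagram \<Rightarrow> 'a diagram set" where
  "diagram_class f = diagram_eq `` {f}"

definition diagram_comp :: "'a diagram \<Rightarrow> 'a diagram \<Rightarrow> 'a diagram" where
  "diagram_comp g f =
    \<lparr>Win = span_comp (Win g) (Win f),
     Wtr = span_add (Wtr f) (span_comp (Wout f) (span_comp (Wtr g) (Win f))),
     Wout = span_comp (Wout f) (Wout g)\<rparr>"

definition diagram_par :: "'a diagram \<Rightarrow> 'a diagram \<Rightarrow> 'a diagram" where
  "diagram_par f g =
    \<lparr>Win = span_par (Win f) (Win g), Wtr = span_par (Wtr f) (Wtr g),
     Wout = span_par (Wout f) (Wout g)\<rparr>"

text \<open>
  The diagram without trace wires that is given by renaming each port \<open>p\<close> of \<open>X\<close> to \<open>h p\<close>.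
  For \<open>h = id\<close> it is the identity of \<open>X\<close>.
\<close>

definition relabel ::
  "('a univ, 'z) iface_scheme \<Rightarrow> ('a univ \<Rightarrow> 'a univ) \<Rightarrow> 'a diagram" where
  "relabel X h =
    \<lparr>Win = \<lparr>apex = inp X, src = h, tgt = id\<rparr>,
     Wtr = \<lparr>apex = {}, src = id, tgt = id\<rparr>,
     Wout = \<lparr>apex = outp X, src = id, tgt = h\<rparr>\<rparr>"

section \<open>Dependencies and the monoidal category dDWD\<close>

definition is_diface :: "'p diface \<Rightarrow> bool" where
  "is_diface X \<longleftrightarrow> finite (inp X) \<and> finite (outp X) \<and> dep X \<subseteq> inp X \<times> outp X"

text \<open>
  The multigraph \<open>f(W) +\<^sub>X d\<^sub>X\<close>. Its vertices are \<open>Inl i\<close> for input ports \<open>i\<close> and \<open>Inr j\<close> for output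
  ports \<open>j\<close>; its arcs are \<open>Inl w\<close> for trace wires \<open>w\<close> and \<open>Inr e\<close> for \<open>e \<in> d\<^sub>X\<close>.
\<close>

definition dep_graph :: "'a univ diface \<Rightarrow> 'a diagram
    \<Rightarrow> ('a univ + 'a univ, 'a univ + 'a univ \<times> 'a univ) pre_digraph" where
  "dep_graph X f =
    \<lparr>verts = inp X <+> outp X,
     arcs = apex (Wtr f) <+> dep X,
     tail = case_sum (\<lambda>w. Inr (src (Wtr f) w)) (\<lambda>e. Inl (fst e)),
     head = case_sum (\<lambda>w. Inl (tgt (Wtr f) w)) (\<lambda>e. Inr (snd e))\<rparr>"

definition acyclic_diagram :: "'a univ diface \<Rightarrow> 'a diagram \<Rightarrow> bool" where
  "acyclic_diagram X f \<longleftrightarrow> \<not> (\<exists>p. pre_digraph.cycle (dep_graph X f) p)"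

definition dep_image :: "'a univ diface \<Rightarrow> 'a diagram \<Rightarrow> ('a univ \<times> 'a univ) set" where
  "dep_image X f = {(src (Win f) v, tgt (Wout f) w) | v p w.
     v \<in> apex (Win f) \<and> w \<in> apex (Wout f) \<and>
     pre_digraph.awalk (dep_graph X f) (Inl (tgt (Win f) v)) p (Inr (src (Wout f) w))}"

text \<open>A morphism: its domain, its codomain, and an isomorphism class of diagrams.\<close>

record 'a wmor =
  wdom :: "'a univ diface"
  wcod :: "'a univ diface"
  wiring :: "'a diagram set"

definition ddwd_mors :: "'a wmor set" where
  "ddwd_mors = {\<lparr>wdom = X, wcod = Y, wiring = diagram_class f\<rparr> | X Y f.
     is_diface X \<and> is_diface Y \<and> is_diagram X Y f \<and>
     dep_image X f \<subseteq> dep Y \<and> acyclic_diagram X f}"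

definition wcomp :: "'a wmor \<Rightarrow> 'a wmor \<Rightarrow> 'a wmor" where
  "wcomp G F = \<lparr>wdom = wdom F, wcod = wcod G,
     wiring = (\<Union>g\<in>wiring G. \<Union>f\<in>wiring F. diagram_class (diagram_comp g f))\<rparr>"

definition tensor_obj :: "'a univ diface \<Rightarrow> 'a univ diface \<Rightarrow> 'a univ diface" where
  "tensor_obj X Y =
    \<lparr>inp = dunion (inp X) (inp Y), outp = dunion (outp X) (outp Y),
     dep = map_prod InL InL ` dep X \<union> map_prod InR InR ` dep Y\<rparr>"

definition tensor_mor :: "'a wmor \<Rightarrow> 'a wmor \<Rightarrow> 'a wmor" where
  "tensor_mor F G =
    \<lparr>wdom = tensor_obj (wdom F) (wdom G), wcod = tensor_obj (wcod F) (wcod G),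
     wiring = (\<Union>f\<in>wiring F. \<Union>g\<in>wiring G. diagram_class (diagram_par f g))\<rparr>"

definition unit_obj :: "'a univ diface" where
  "unit_obj = \<lparr>inp = {}, outp = {}, dep = {}\<rparr>"

definition relabel_mor ::
  "'a univ diface \<Rightarrow> 'a univ diface \<Rightarrow> ('a univ \<Rightarrow> 'a univ) \<Rightarrow> 'a wmor" where
  "relabel_mor X Y h = \<lparr>wdom = X, wcod = Y, wiring = diagram_class (relabel X h)\<rparr>"

definition dDWD :: "('a univ diface, 'a wmor) moncat" where
  "dDWD =
    \<lparr>Ob = {X. is_diface X}, Ar = ddwd_mors, Dom = wdom, Cod = wcod,
     Idt = (\<lambda>X. relabel_mor X X id), Comp = wcomp,
     TenO = tensor_obj, TenA = tensor_mor, Unit = unit_obj,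
     Assoc = (\<lambda>X Y Z. relabel_mor (tensor_obj (tensor_obj X Y) Z) (tensor_obj X (tensor_obj Y Z))
       (copair (copair InL (InR \<circ> InL)) (InR \<circ> InR))),
     Lunit = (\<lambda>X. relabel_mor (tensor_obj unit_obj X) X (copair id id)),
     Runit = (\<lambda>X. relabel_mor (tensor_obj X unit_obj) X (copair id id))\<rparr>"

section \<open>Mealy machines\<close>

type_synonym 'a vec = "'a univ \<Rightarrow> real"

record 'a machine =
  states :: "'a univ set"
  update :: "'a vec \<times> 'a vec \<Rightarrow> 'a vec"
  readout :: "'a vec \<times> 'a vec \<Rightarrow> 'a vec"

definition machines :: "'a univ diface \<Rightarrow> 'a machine set" where
  "machines X = {m. finite (states m) \<and>
     update m \<in> RR (inp X) \<times> RR (states m) \<rightarrow> RR (states m) \<and>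
     readout m \<in> RR (inp X) \<times> RR (states m) \<rightarrow> RR (outp X) \<and>
     (\<forall>x\<in>RR (states m). respects_span (inp X) (outp X) (rel_span (dep X)) (\<lambda>a. readout m (a, x)))}"

text \<open>
  The values of \<open>update\<close> and \<open>readout\<close> outside their domains are irrelevant: the relation below
  does not depend on them. A bijection \<open>h\<close> from \<open>S\<close> to \<open>S'\<close> identifies \<open>RR S'\<close> with \<open>RR S\<close> by \<open>pull\<close>.
\<close>

definition machine_eq :: "'a univ diface \<Rightarrow> ('a machine \<times> 'a machine) set" where
  "machine_eq X = {(m, m'). m \<in> machines X \<and> m' \<in> machines X \<and>
     (\<exists>h. bij_betw h (states m) (states m') \<and>
       (\<forall>a\<in>RR (inp X). \<forall>x\<in>RR (states m').
          update m (a, pull (states m) h x) = pull (states m) h (update m' (a, x)) \<and>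
          readout m (a, pull (states m) h x) = readout m' (a, x)))}"

definition Mealy :: "'a univ diface \<Rightarrow> 'a machine set set" where
  "Mealy X = machines X // machine_eq X"

definition machine_class :: "'a univ diface \<Rightarrow> 'a machine \<Rightarrow> 'a machine set" where
  "machine_class X m = machine_eq X `` {m}"

text \<open>The fixed point determined by a readout \<open>r\<close>, an input offset \<open>a\<close> and a state \<open>x\<close>.\<close>

definition fixpt :: "'a univ diface \<Rightarrow> 'a diagram \<Rightarrow> ('a vec \<times> 'a vec \<Rightarrow> 'a vec)
    \<Rightarrow> 'a vec \<Rightarrow> 'a vec \<Rightarrow> 'a vec \<times> 'a vec" where
  "fixpt X f r a x = (THE p. p \<in> RR (inp X) \<times> RR (outp X) \<and>
     p = (vadd (inp X) (span_map (inp X) (Wtr f) (snd p)) a, r (fst p, x)))"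

definition act :: "'a univ diface \<Rightarrow> 'a univ diface \<Rightarrow> 'a diagram \<Rightarrow> 'a machine \<Rightarrow> 'a machine" where
  "act X Y f m =
    \<lparr>states = states m,
     update = (\<lambda>(y, x).
       update m (fst (fixpt X f (readout m) (span_map (inp X) (Win f) y) x), x)),
     readout = (\<lambda>(y, x).
       span_map (outp Y) (Wout f) (snd (fixpt X f (readout m) (span_map (inp X) (Win f) y) x)))\<rparr>"

definition Mealy_map :: "'a wmor \<Rightarrow> 'a machine set \<Rightarrow> 'a machine set" where
  "Mealy_map F M =
     (\<Union>f\<in>wiring F. \<Union>m\<in>M. machine_class (wcod F) (act (wdom F) (wcod F) f m))"

text \<open>\<open>split_vec\<close> and \<open>join_vec\<close> are the two directions of \<open>\<real>\<^bsup>A+B\<^esup> \<cong> \<real>\<^sup>A \<times> \<real>\<^sup>B\<close>.\<close>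

definition split_vec :: "'a univ set \<Rightarrow> 'a univ set \<Rightarrow> 'a vec \<Rightarrow> 'a vec \<times> 'a vec" where
  "split_vec A B x = (pull A InL x, pull B InR x)"

definition join_vec :: "'a univ set \<Rightarrow> 'a univ set \<Rightarrow> 'a vec \<times> 'a vec \<Rightarrow> 'a vec" where
  "join_vec A B p = (\<lambda>i\<in>dunion A B. copair (fst p) (snd p) i)"

definition juxtapose :: "'a univ diface \<Rightarrow> 'a univ diface
    \<Rightarrow> 'a machine \<Rightarrow> 'a machine \<Rightarrow> 'a machine" where
  "juxtapose X Y m n =
    \<lparr>states = dunion (states m) (states n),
     update = (\<lambda>(c, z).
       let (a, b) = split_vec (inp X) (inp Y) c; (x, y) = split_vec (states m) (states n) z
       in join_vec (states m) (states n) (update m (a, x), update n (b, y))),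
     readout = (\<lambda>(c, z).
       let (a, b) = split_vec (inp X) (inp Y) c; (x, y) = split_vec (states m) (states n) z
       in join_vec (outp X) (outp Y) (readout m (a, x), readout n (b, y)))\<rparr>"

definition Mealy_laxator :: "'a univ diface \<Rightarrow> 'a univ diface
    \<Rightarrow> 'a machine set \<times> 'a machine set \<Rightarrow> 'a machine set" where
  "Mealy_laxator X Y = (\<lambda>(M, N).
     \<Union>m\<in>M. \<Union>n\<in>N. machine_class (tensor_obj X Y) (juxtapose X Y m n))"

text \<open>The machine with no states; each of its two maps is the constant map to \<open>RR {}\<close>.\<close>

definition trivial_machine :: "'a machine" where
  "trivial_machine = \<lparr>states = {}, update = (\<lambda>_ _. undefined), readout = (\<lambda>_ _. undefined)\<rparr>"

definition Mealy_unit :: "unit \<Rightarrow> 'a machine set" where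
  "Mealy_unit = (\<lambda>_. machine_class unit_obj trivial_machine)"

end

theory Submission
  imports Defs
begin

text \<open>
  Both halves of the theorem, that wiring diagrams with dependencies form a monoidal category and
  that Mealy machines are a lax monoidal functor on it, rest on two observations.

  The first is that a span \<open>A \<leftarrow> R \<rightarrow> B\<close> of finite sets is determined up to isomorphism by
  the linear map \<open>R\<^sup>*\<close>, whose matrix counts the elements of the apex over each pair of points
  (\<open>map_eq_imp_span_iso\<close>). Since \<open>R \<mapsto> R\<^sup>*\<close> takes fibre products to composites and sums to sums, a
  diagram is determined by three linear maps, which compose by simple formulas
  (\<open>wire_maps_comp\<close>, \<open>wire_maps_par\<close>). Equations between diagrams, such as associativity or the
  naturality of the associator, become identities of linear maps, and the coherence conditions for
  the structure morphisms become equations between functions on ports. The only graph-theoretic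
  point is that acyclicity and the bound on dependencies survive composition: a path in the graph
  of a composite decomposes into paths inside the inner diagram, which are dependencies of the middle
  object, and trace wires of the outer diagram (\<open>dep_edges_comp_trancl\<close>).

  The second is that the feedback equations of a machine in an acyclic diagram can be solved port
  by port in the order given by the dependency graph (\<open>feedback_sol_exists\<close>), and that
  the value at a port depends only on the inputs from which this port can be reached
  (\<open>feedback_sol_agree\<close>). The latter gives uniqueness of the fixed point and
  also shows that the new readout respects the dependency of the codomain (\<open>act_machines\<close>). Because of
  uniqueness, functoriality and naturality only require to check that a candidate
  satisfies the equations: for a composite diagram this is the fixed point of the inner
  diagram at the input that the outer one determines (\<open>act_comp\<close>), for a parallel diagram the
  pair of fixed points (\<open>act_par\<close>), and for a relabelling the input itself (\<open>act_relabel\<close>).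
  Everything is then transported to classes of diagrams and machines, on which the
  operations do not depend on representatives.
\<close>

section \<open>Spans and their linear maps\<close>

lemma RR_eqI:
  assumes "x \<in> RR A" "y \<in> RR A" "\<And>a. a \<in> A \<Longrightarrow> x a = y a"
  shows "x = y"
  using assms unfolding RR_def by (meson PiE_ext)

lemma RR_outside: "x \<in> RR A \<Longrightarrow> a \<notin> A \<Longrightarrow> x a = undefined"
  unfolding RR_def by (auto simp: PiE_def extensional_def)

lemma pull_RR [simp]: "pull A f x \<in> RR A"
  unfolding RR_def pull_def by auto

lemma vadd_RR [simp]: "vadd A x y \<in> RR A"
  unfolding RR_def vadd_def by auto

lemma push_RR [simp]: "push A f B x \<in> RR B"
  unfolding RR_def push_def by auto

lemma span_map_RR [simp]: "span_map B R x \<in> RR B"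
  unfolding span_map_def by simp

lemma pull_apply: "a \<in> A \<Longrightarrow> pull A f x a = x (f a)"
  unfolding pull_def by simp

lemma vadd_apply: "a \<in> A \<Longrightarrow> vadd A x y a = x a + y a"
  unfolding vadd_def by simp

lemma pull_id: "x \<in> RR A \<Longrightarrow> (\<And>a. a \<in> A \<Longrightarrow> f a = a) \<Longrightarrow> pull A f x = x"
  by (rule RR_eqI[where A = A]) (auto simp: pull_apply)

lemma pull_pull: "f \<in> A \<rightarrow> B \<Longrightarrow> pull A f (pull B g x) = pull A (g \<circ> f) x"
  by (rule RR_eqI[where A = A]) (auto simp: pull_apply Pi_iff)

lemma push_inverse:
  assumes "h \<in> A \<rightarrow> B" "k \<in> B \<rightarrow> A" "\<And>a. a \<in> A \<Longrightarrow> k (h a) = a" "\<And>b. b \<in> B \<Longrightarrow> h (k b) = b"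
  shows "push A h B x = pull B k x"
proof (rule RR_eqI[where A = B])
  fix b assume b: "b \<in> B"
  then have "{a \<in> A. h a = b} = {k b}"
    using assms by auto
  with b show "push A h B x b = pull B k x b"
    by (simp add: push_def pull_def)
qed auto

lemma vadd_assoc: "vadd A (vadd A x y) z = vadd A x (vadd A y z)"
  by (rule RR_eqI[where A = A]) (simp_all add: vadd_apply)

lemma span_map_apply:
  "b \<in> B \<Longrightarrow> span_map B R x b = (\<Sum>w | w \<in> apex R \<and> tgt R w = b. x (src R w))"
  unfolding span_map_def push_def pull_def by (auto intro!: sum.cong)

lemma span_map_vadd:
  assumes "is_span A B R"
  shows "span_map B R (vadd A x y) = vadd B (span_map B R x) (span_map B R y)"
proof (rule RR_eqI[where A = B])
  fix b assume b: "b \<in> B"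
  have "(\<Sum>w | w \<in> apex R \<and> tgt R w = b. vadd A x y (src R w))
    = (\<Sum>w | w \<in> apex R \<and> tgt R w = b. x (src R w) + y (src R w))"
    using assms unfolding is_span_def by (intro sum.cong) (auto simp: vadd_apply Pi_iff)
  with b show "span_map B R (vadd A x y) b = vadd B (span_map B R x) (span_map B R y) b"
    by (simp add: span_map_apply vadd_apply sum.distrib)
qed auto

text \<open>
  Two finite families with the same number of members over each label are related by a
  label-preserving bijection, glued from bijections between the fibres.
\<close>

lemma bij_betw_of_equal_fibres:
  assumes "finite A" "finite B"
    and card: "\<And>k. card {a \<in> A. f a = k} = card {b \<in> B. g b = k}"
  shows "\<exists>h. bij_betw h A B \<and> (\<forall>a\<in>A. g (h a) = f a)"
proof -
  have "\<forall>k. \<exists>h. bij_betw h {a \<in> A. f a = k} {b \<in> B. g b = k}"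
    using assms by (auto intro!: finite_same_card_bij)
  then obtain H where H: "\<And>k. bij_betw (H k) {a \<in> A. f a = k} {b \<in> B. g b = k}"
    by metis
  have in_fibre: "H (f a) a \<in> B \<and> g (H (f a) a) = f a" if "a \<in> A" for a
    using bij_betw_apply[OF H, of a "f a"] that by auto
  have "bij_betw (\<lambda>a. H (f a) a) A B"
  proof (rule bij_betw_imageI)
    show "inj_on (\<lambda>a. H (f a) a) A"
    proof (rule inj_onI)
      fix a a' assume aa: "a \<in> A" "a' \<in> A" "H (f a) a = H (f a') a'"
      then have "f a = f a'"
        using in_fibre by metis
      with aa show "a = a'"
        using bij_betw_imp_inj_on[OF H[of "f a"]] by (auto dest: inj_onD)
    qed
    show "(\<lambda>a. H (f a) a) ` A = B"
    proof (intro equalityI subsetI)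
      fix b assume "b \<in> B"
      then have "b \<in> H (g b) ` {a \<in> A. f a = g b}"
        using bij_betw_imp_surj_on[OF H[of "g b"]] by auto
      then obtain a where "a \<in> A" "f a = g b" "b = H (g b) a"
        by auto
      then show "b \<in> (\<lambda>a. H (f a) a) ` A"
        by (intro image_eqI[of _ _ a]) simp_all
    qed (use in_fibre in auto)
  qed
  with in_fibre show ?thesis
    by blast
qed

lemma span_iso_imp_map_eq:
  assumes "span_iso R Q"
  shows "span_map B R = span_map B Q"
proof
  fix x
  obtain h where h: "bij_betw h (apex R) (apex Q)"
    and st: "\<And>w. w \<in> apex R \<Longrightarrow> src Q (h w) = src R w \<and> tgt Q (h w) = tgt R w"
    using assms unfolding span_iso_def by auto
  show "span_map B R x = span_map B Q x"
  proof (rule RR_eqI[where A = B])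
    fix b assume b: "b \<in> B"
    have "bij_betw h {w \<in> apex R. tgt R w = b} {w \<in> apex Q. tgt Q w = b}"
      using h st by (fastforce simp: bij_betw_def inj_on_def)
    then have "(\<Sum>w | w \<in> apex R \<and> tgt R w = b. x (src Q (h w)))
        = (\<Sum>w | w \<in> apex Q \<and> tgt Q w = b. x (src Q w))"
      by (rule sum.reindex_bij_betw)
    moreover have "(\<Sum>w | w \<in> apex R \<and> tgt R w = b. x (src Q (h w)))
        = (\<Sum>w | w \<in> apex R \<and> tgt R w = b. x (src R w))"
      using st by (intro sum.cong) auto
    ultimately show "span_map B R x b = span_map B Q x b"
      using b by (simp add: span_map_apply)
  qed auto
qed

text \<open>
  The coefficients of the linear map in the standard bases are the sizes of the fibres of the apex
  over pairs of points.
\<close>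

lemma span_map_indicator:
  assumes "is_span A B R" "b \<in> B"
  shows "span_map B R (\<lambda>a'\<in>A. if a' = a then 1 else 0) b
    = real (card {w \<in> apex R. (src R w, tgt R w) = (a, b)})"
proof -
  have fin: "finite {w \<in> apex R. tgt R w = b}"
    using assms unfolding is_span_def by auto
  have "(\<Sum>w | w \<in> apex R \<and> tgt R w = b. (\<lambda>a'\<in>A. if a' = a then 1 else 0) (src R w))
      = (\<Sum>w | w \<in> apex R \<and> tgt R w = b. if src R w = a then 1 else 0 :: real)"
    using assms unfolding is_span_def by (intro sum.cong) (auto simp: Pi_iff)
  also have "\<dots> = (\<Sum>w | w \<in> {w \<in> apex R. tgt R w = b} \<and> src R w = a. 1)"
    by (rule sum.inter_filter[OF fin, symmetric])
  also have "\<dots> = real (card {w \<in> apex R. (src R w, tgt R w) = (a, b)})"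
    by (simp add: conj_ac)
  finally show ?thesis
    using assms by (simp add: span_map_apply)
qed

text \<open>
  Two spans that induce the same linear map have equally large fibres over every pair of points,
  and bijections between these fibres glue to an isomorphism. This turns each equation
  between wiring diagrams into an identity between linear maps, and spares the explicit bijections
  between iterated fibre products and disjoint unions.
\<close>

lemma map_eq_imp_span_iso:
  assumes R: "is_span A B R" and Q: "is_span A B Q"
    and eq: "\<And>x. x \<in> RR A \<Longrightarrow> span_map B R x = span_map B Q x"
  shows "span_iso R Q"
proof -
  have "card {w \<in> apex R. (src R w, tgt R w) = k} = card {w \<in> apex Q. (src Q w, tgt Q w) = k}" for k
  proof (cases "snd k \<in> B")
    case True
    have "(\<lambda>a'\<in>A. if a' = fst k then 1 else 0) \<in> RR A"
      unfolding RR_def by auto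
    from span_map_indicator[OF R True, of "fst k"] span_map_indicator[OF Q True, of "fst k"] eq[OF this]
    show ?thesis
      by simp
  next
    case False
    then have "{w \<in> apex R. (src R w, tgt R w) = k} = {}" "{w \<in> apex Q. (src Q w, tgt Q w) = k} = {}"
      using R Q unfolding is_span_def by auto
    then show ?thesis
      by (simp only:)
  qed
  then have "\<exists>h. bij_betw h (apex R) (apex Q) \<and>
      (\<forall>w\<in>apex R. (src Q (h w), tgt Q (h w)) = (src R w, tgt R w))"
    using R Q unfolding is_span_def by (intro bij_betw_of_equal_fibres) auto
  then show ?thesis
    unfolding span_iso_def by auto
qed

lemma span_iso_refl: "span_iso R R"
  unfolding span_iso_def by (auto intro!: exI[of _ id])

lemma span_iso_sym: "span_iso R Q \<Longrightarrow> span_iso Q R"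
proof -
  assume "span_iso R Q"
  then obtain h where h: "bij_betw h (apex R) (apex Q)"
    and st: "\<And>w. w \<in> apex R \<Longrightarrow> src Q (h w) = src R w \<and> tgt Q (h w) = tgt R w"
    unfolding span_iso_def by auto
  have "src R (inv_into (apex R) h w) = src Q w \<and> tgt R (inv_into (apex R) h w) = tgt Q w"
    if "w \<in> apex Q" for w
    using st[of "inv_into (apex R) h w"] bij_betw_inv_into_right[OF h that]
      bij_betw_apply[OF bij_betw_inv_into[OF h] that] by simp
  then show "span_iso Q R"
    unfolding span_iso_def using bij_betw_inv_into[OF h] by blast
qed

lemma span_iso_trans: "span_iso R Q \<Longrightarrow> span_iso Q P \<Longrightarrow> span_iso R P"
proof -
  assume "span_iso R Q" "span_iso Q P"
  then obtain h k where h: "bij_betw h (apex R) (apex Q)" and k: "bij_betw k (apex Q) (apex P)"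
    and "\<And>w. w \<in> apex R \<Longrightarrow> src Q (h w) = src R w \<and> tgt Q (h w) = tgt R w"
    and "\<And>w. w \<in> apex Q \<Longrightarrow> src P (k w) = src Q w \<and> tgt P (k w) = tgt Q w"
    unfolding span_iso_def by auto
  then show "span_iso R P"
    unfolding span_iso_def
    by (intro exI[of _ "k \<circ> h"]) (auto intro: bij_betw_trans dest: bij_betw_apply)
qed

lemma is_span_iso: "is_span A B R \<Longrightarrow> span_iso R Q \<Longrightarrow> is_span A B Q"
proof -
  assume R: "is_span A B R" and "span_iso R Q"
  then obtain h where h: "h ` apex R = apex Q"
    and st: "\<And>w. w \<in> apex R \<Longrightarrow> src Q (h w) = src R w \<and> tgt Q (h w) = tgt R w"
    unfolding span_iso_def bij_betw_def by auto
  show "is_span A B Q"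
    using R st unfolding is_span_def h[symmetric] by auto
qed

lemma is_span_comp:
  assumes "is_span A B R" "is_span B C Q"
  shows "is_span A C (span_comp R Q)"
proof -
  have "{Pr v w | v w. v \<in> apex R \<and> w \<in> apex Q \<and> tgt R v = src Q w}
      \<subseteq> (\<lambda>(v, w). Pr v w) ` (apex R \<times> apex Q)"
    by auto
  then have "finite {Pr v w | v w. v \<in> apex R \<and> w \<in> apex Q \<and> tgt R v = src Q w}"
    by (rule finite_subset) (use assms in \<open>auto simp: is_span_def\<close>)
  then show ?thesis
    using assms unfolding is_span_def span_comp_def by auto
qed

lemma is_span_add: "is_span A B R \<Longrightarrow> is_span A B Q \<Longrightarrow> is_span A B (span_add R Q)"
  unfolding is_span_def span_add_def dunion_def by auto

lemma is_span_par:
  "is_span A B R \<Longrightarrow> is_span A' B' Q \<Longrightarrow> is_span (dunion A A') (dunion B B') (span_par R Q)"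
  unfolding is_span_def span_par_def dunion_def by auto

text \<open>
  Functoriality of \<open>R \<mapsto> R\<^sup>*\<close>: a sum over a fibre of the fibre product is an iterated sum, first over
  the wires into a given middle point and then over the wires out of it.
\<close>

lemma span_map_comp:
  assumes R: "is_span A B R" and Q: "is_span B C Q"
  shows "span_map C (span_comp R Q) x = span_map C Q (span_map B R x)"
proof (rule RR_eqI[where A = C])
  fix c assume c: "c \<in> C"
  let ?W = "{w \<in> apex Q. tgt Q w = c}"
  have "span_map C Q (span_map B R x) c
      = (\<Sum>w\<in>?W. \<Sum>v | v \<in> apex R \<and> tgt R v = src Q w. x (src R v))"
    using c Q unfolding is_span_def by (auto simp: span_map_apply Pi_iff intro!: sum.cong)
  also have "\<dots> = (\<Sum>(w, v)\<in>(SIGMA w:?W. {v \<in> apex R. tgt R v = src Q w}). x (src R v))"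
    using R Q unfolding is_span_def by (intro sum.Sigma) auto
  also have "\<dots> = (\<Sum>u | u \<in> apex (span_comp R Q) \<and> tgt (span_comp R Q) u = c.
      x (src (span_comp R Q) u))"
    by (rule sum.reindex_bij_witness[of _ "\<lambda>u. (prsnd u, prfst u)" "\<lambda>(w, v). Pr v w"])
      (auto simp: span_comp_def)
  finally show "span_map C (span_comp R Q) x c = span_map C Q (span_map B R x) c"
    using c by (simp add: span_map_apply)
qed auto

lemma sum_dunion:
  assumes "finite A" "finite B"
  shows "(\<Sum>i | i \<in> dunion A B \<and> P i. x i)
    = (\<Sum>a | a \<in> A \<and> P (InL a). x (InL a)) + (\<Sum>b | b \<in> B \<and> P (InR b). x (InR b))"
proof -
  have "{i \<in> dunion A B. P i} = InL ` {a \<in> A. P (InL a)} \<union> InR ` {b \<in> B. P (InR b)}"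
    unfolding dunion_def by auto
  then show ?thesis
    using assms by (simp, subst sum.union_disjoint) (auto simp: sum.reindex inj_on_def)
qed

lemma span_map_add:
  assumes "is_span A B R" "is_span A B Q"
  shows "span_map B (span_add R Q) x = vadd B (span_map B R x) (span_map B Q x)"
  using assms unfolding is_span_def
  by (intro RR_eqI[where A = B]) (auto simp: span_map_apply vadd_apply span_add_def sum_dunion)

lemma mem_dunion [simp]:
  "InL a \<in> dunion A B \<longleftrightarrow> a \<in> A" "InR b \<in> dunion A B \<longleftrightarrow> b \<in> B"
  "Atom c \<notin> dunion A B" "Pr u v \<notin> dunion A B"
  unfolding dunion_def by auto

lemma finite_dunion [simp]: "finite A \<Longrightarrow> finite B \<Longrightarrow> finite (dunion A B)"
  unfolding dunion_def by simp

lemma RR_dunion_eqI: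
  assumes "x \<in> RR (dunion A B)" "y \<in> RR (dunion A B)"
    and "\<And>a. a \<in> A \<Longrightarrow> x (InL a) = y (InL a)" "\<And>b. b \<in> B \<Longrightarrow> x (InR b) = y (InR b)"
  shows "x = y"
  using assms by (intro RR_eqI[of x "dunion A B" y]) (auto simp: dunion_def)

lemma join_vec_RR [simp]: "join_vec A B p \<in> RR (dunion A B)"
  unfolding join_vec_def RR_def by auto

lemma join_vec_apply:
  "a \<in> A \<Longrightarrow> join_vec A B p (InL a) = fst p a" "b \<in> B \<Longrightarrow> join_vec A B p (InR b) = snd p b"
  unfolding join_vec_def by simp_all

lemma pull_join:
  "x \<in> RR A \<Longrightarrow> pull A InL (join_vec A B (x, y)) = x"
  "y \<in> RR B \<Longrightarrow> pull B InR (join_vec A B (x, y)) = y"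
  by (rule RR_eqI[where A = A]; simp add: pull_apply join_vec_apply)
    (rule RR_eqI[where A = B]; simp add: pull_apply join_vec_apply)

lemma join_vadd:
  "join_vec A B (vadd A x y, vadd B x' y')
    = vadd (dunion A B) (join_vec A B (x, x')) (join_vec A B (y, y'))"
  by (rule RR_dunion_eqI[of _ A B]) (auto simp: vadd_apply join_vec_apply)

lemma span_map_par:
  assumes "is_span A B R" "is_span A' B' Q"
  shows "span_map (dunion B B') (span_par R Q) x
    = join_vec B B' (span_map B R (pull A InL x), span_map B' Q (pull A' InR x))"
  using assms unfolding is_span_def
  by (intro RR_dunion_eqI[where A = B and B = B']) (auto simp: span_map_apply join_vec_apply span_par_def sum_dunion
      pull_apply Pi_iff intro!: sum.cong)

section \<open>Paths in dependency graphs\<close>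

text \<open>
  Both acyclicity and the induced dependency ask only which ports can be reached from which, so
  the multigraph is replaced by the relation of its arcs; parallel wires become one edge.
\<close>

definition dep_edges :: "'a univ diface \<Rightarrow> 'a diagram \<Rightarrow> ('a univ + 'a univ) rel" where
  "dep_edges X f = (\<lambda>w. (Inr (src (Wtr f) w), Inl (tgt (Wtr f) w))) ` apex (Wtr f)
     \<union> (\<lambda>(i, j). (Inl i, Inr j)) ` dep X"

lemma dep_edgesI:
  "w \<in> apex (Wtr f) \<Longrightarrow> (Inr (src (Wtr f) w), Inl (tgt (Wtr f) w)) \<in> dep_edges X f"
  "(i, j) \<in> dep X \<Longrightarrow> (Inl i, Inr j) \<in> dep_edges X f"
  unfolding dep_edges_def by auto

lemma finite_dep_edges:
  assumes "is_diface X" "is_diagram X Y f"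
  shows "finite (dep_edges X f)"
proof -
  have "finite (dep X)"
    using assms unfolding is_diface_def by (auto intro: finite_subset)
  then show ?thesis
    using assms unfolding dep_edges_def is_diagram_def is_span_def by auto
qed

lemma arcs_ends_dep_graph: "arcs_ends (dep_graph X f) = dep_edges X f"
  unfolding arcs_ends_def arc_to_ends_def dep_graph_def dep_edges_def
  by (simp add: Plus_def image_Un image_image case_prod_unfold)

lemma wf_dep_graph:
  assumes "is_diface X" "is_diagram X Y f"
  shows "wf_digraph (dep_graph X f)"
  using assms unfolding is_diface_def is_diagram_def is_span_def
  by unfold_locales (auto simp: dep_graph_def)

text \<open>
  A cycle repeats no vertex except its end point, whereas \<^const>\<open>acyclic\<close> excludes all
  nonempty closed walks; these conditions agree because each closed walk contains a cycle.
\<close>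

lemma acyclic_diagram_iff:
  assumes "is_diface X" "is_diagram X Y f"
  shows "acyclic_diagram X f \<longleftrightarrow> acyclic (dep_edges X f)"
proof -
  interpret wf_digraph "dep_graph X f"
    using assms by (rule wf_dep_graph)
  have "(\<exists>p. cycle p) \<longleftrightarrow> (\<exists>u p. awalk u p u \<and> p \<noteq> [])"
    using closed_w_imp_cycle unfolding closed_w_def cycle_def by blast
  also have "\<dots> \<longleftrightarrow> (\<exists>u. (u, u) \<in> (dep_edges X f)\<^sup>+)"
    by (simp add: reachable1_awalk flip: arcs_ends_dep_graph)
  finally show ?thesis
    unfolding acyclic_diagram_def acyclic_def by blast
qed

text \<open>
  A directed path that witnesses a dependency leads from an input to an output port, so that it
  has at least one arc.
\<close>

lemma dep_image_iff:
  assumes "is_diface X" "is_diagram X Y f"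
  shows "(i, j) \<in> dep_image X f \<longleftrightarrow> (\<exists>v\<in>apex (Win f). \<exists>w\<in>apex (Wout f).
    i = src (Win f) v \<and> j = tgt (Wout f) w \<and>
    (Inl (tgt (Win f) v), Inr (src (Wout f) w)) \<in> (dep_edges X f)\<^sup>+)"
proof -
  interpret wf_digraph "dep_graph X f"
    using assms by (rule wf_dep_graph)
  have "(\<exists>p. awalk (Inl k) p (Inr l)) \<longleftrightarrow> (Inl k, Inr l) \<in> (dep_edges X f)\<^sup>+" for k l
    unfolding arcs_ends_dep_graph[symmetric] reachable1_awalk by (metis awalk_empty_ends sum.distinct(2))
  then show ?thesis
    unfolding dep_image_def by blast
qed

definition admissible :: "'a univ diface \<Rightarrow> 'a univ diface \<Rightarrow> 'a diagram \<Rightarrow> bool" where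
  "admissible X Y f \<longleftrightarrow> is_diface X \<and> is_diface Y \<and> is_diagram X Y f \<and>
     dep_image X f \<subseteq> dep Y \<and> acyclic_diagram X f"

lemma admissible_iff:
  "admissible X Y f \<longleftrightarrow> is_diface X \<and> is_diface Y \<and> is_diagram X Y f \<and>
     (\<forall>v\<in>apex (Win f). \<forall>w\<in>apex (Wout f).
        (Inl (tgt (Win f) v), Inr (src (Wout f) w)) \<in> (dep_edges X f)\<^sup>+
          \<longrightarrow> (src (Win f) v, tgt (Wout f) w) \<in> dep Y) \<and>
     acyclic (dep_edges X f)"
proof -
  have "dep_image X f \<subseteq> dep Y \<longleftrightarrow> (\<forall>v\<in>apex (Win f). \<forall>w\<in>apex (Wout f).
      (Inl (tgt (Win f) v), Inr (src (Wout f) w)) \<in> (dep_edges X f)\<^sup>+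
        \<longrightarrow> (src (Win f) v, tgt (Wout f) w) \<in> dep Y)"
    if "is_diface X" "is_diagram X Y f"
    by (simp only: subset_iff split_paired_All dep_image_iff[OF that]) blast
  then show ?thesis
    unfolding admissible_def using acyclic_diagram_iff by blast
qed

lemma admissibleD:
  assumes "admissible X Y f"
  shows "is_diface X" "is_diface Y" "is_diagram X Y f"
    "is_span (inp Y) (inp X) (Win f)" "is_span (outp X) (inp X) (Wtr f)"
    "is_span (outp X) (outp Y) (Wout f)"
  using assms unfolding admissible_def is_diagram_def by auto

lemma is_diagram_comp:
  "is_diagram X Y f \<Longrightarrow> is_diagram Y Z g \<Longrightarrow> is_diagram X Z (diagram_comp g f)"
  unfolding is_diagram_def diagram_comp_def by (auto intro!: is_span_comp is_span_add)

text \<open>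
  A path in the graph of a composite either stays in the graph of the inner diagram \<open>f\<close>, or
  it is cut by the composite trace wires into paths in the graph of \<open>f\<close>. The inner pieces
  run from an input to an output wire of \<open>f\<close>, so they give dependencies on the middle object and
  assemble, together with the trace wires of \<open>g\<close>, to a path in the graph of \<open>g\<close>.
\<close>

lemma dep_edges_comp_trancl:
  assumes f: "admissible X Y f"
    and path: "(u, v) \<in> (dep_edges X (diagram_comp g f))\<^sup>+"
  shows "(u, v) \<in> (dep_edges X f)\<^sup>+ \<or> (\<exists>wo\<in>apex (Wout f). \<exists>wi\<in>apex (Win f).
    (u, Inr (src (Wout f) wo)) \<in> (dep_edges X f)\<^sup>* \<and>
    (Inr (tgt (Wout f) wo), Inl (src (Win f) wi)) \<in> (dep_edges Y g)\<^sup>+ \<and>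
    (Inl (tgt (Win f) wi), v) \<in> (dep_edges X f)\<^sup>*)"
    (is "_ \<or> ?through u v")
proof -
  have edge: "(u, v) \<in> dep_edges X f \<or> ?through u v"
    if "(u, v) \<in> dep_edges X (diagram_comp g f)" for u v
  proof -
    from that consider
        i j where "(i, j) \<in> dep X" "u = Inl i" "v = Inr j"
      | w where "w \<in> apex (Wtr f)" "u = Inr (src (Wtr f) w)" "v = Inl (tgt (Wtr f) w)"
      | wo wt wi where "wo \<in> apex (Wout f)" "wt \<in> apex (Wtr g)" "wi \<in> apex (Win f)"
          "tgt (Wout f) wo = src (Wtr g) wt" "tgt (Wtr g) wt = src (Win f) wi"
          "u = Inr (src (Wout f) wo)" "v = Inl (tgt (Win f) wi)"
      unfolding dep_edges_def diagram_comp_def span_add_def span_comp_def dunion_def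
      by auto
    then show ?thesis
    proof cases
      case (3 wo wt wi)
      have "(Inr (src (Wtr g) wt), Inl (tgt (Wtr g) wt)) \<in> (dep_edges Y g)\<^sup>+"
        using 3(2) by (intro r_into_trancl dep_edgesI)
      with 3 have "?through u v"
        by (intro bexI[of _ wo] bexI[of _ wi]) simp_all
      then show ?thesis ..
    qed (auto intro: dep_edgesI)
  qed
  show ?thesis
    using path
  proof (induction rule: trancl_induct)
    case (base v)
    then show ?case
      using edge by blast
  next
    case (step v z)
    from edge[OF step(2)] show ?case
    proof
      assume "(v, z) \<in> dep_edges X f"
      with step.IH show ?thesis
        by (meson trancl_into_trancl rtrancl_into_rtrancl)
    next
      assume "?through v z"
      then obtain wo wi where w: "wo \<in> apex (Wout f)" "wi \<in> apex (Win f)"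
        and vo: "(v, Inr (src (Wout f) wo)) \<in> (dep_edges X f)\<^sup>*"
        and g: "(Inr (tgt (Wout f) wo), Inl (src (Win f) wi)) \<in> (dep_edges Y g)\<^sup>+"
        and iz: "(Inl (tgt (Win f) wi), z) \<in> (dep_edges X f)\<^sup>*"
        by blast
      from step.IH have "?through u z"
      proof
        assume "(u, v) \<in> (dep_edges X f)\<^sup>+"
        with vo have "(u, Inr (src (Wout f) wo)) \<in> (dep_edges X f)\<^sup>*"
          by (meson trancl_into_rtrancl rtrancl_trans)
        with w g iz show ?thesis
          by blast
      next
        assume "?through u v"
        then obtain wo' wi' where w': "wo' \<in> apex (Wout f)" "wi' \<in> apex (Win f)"
          and uo: "(u, Inr (src (Wout f) wo')) \<in> (dep_edges X f)\<^sup>*"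
          and g': "(Inr (tgt (Wout f) wo'), Inl (src (Win f) wi')) \<in> (dep_edges Y g)\<^sup>+"
          and iv: "(Inl (tgt (Win f) wi'), v) \<in> (dep_edges X f)\<^sup>*"
          by blast
        have "(Inl (tgt (Win f) wi'), Inr (src (Wout f) wo)) \<in> (dep_edges X f)\<^sup>*"
          using iv vo by (rule rtrancl_trans)
        then have "(Inl (tgt (Win f) wi'), Inr (src (Wout f) wo)) \<in> (dep_edges X f)\<^sup>+"
          by (simp add: rtrancl_eq_or_trancl)
        then have "(src (Win f) wi', tgt (Wout f) wo) \<in> dep Y"
          using f w w' unfolding admissible_iff by blast
        then have "(Inl (src (Win f) wi'), Inr (tgt (Wout f) wo)) \<in> dep_edges Y g"
          by (rule dep_edgesI)
        with g g' have "(Inr (tgt (Wout f) wo'), Inl (src (Win f) wi)) \<in> (dep_edges Y g)\<^sup>+"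
          by (meson trancl_into_trancl trancl_trans)
        with w w' uo iz show ?thesis
          by blast
      qed
      then show ?thesis ..
    qed
  qed
qed

text \<open>
  A cycle in the graph of the composite through an outer trace wire closes up in the graph of \<open>g\<close>,
  since its piece from the last to the first outer trace wire, inside \<open>f\<close>, is a dependency of the
  middle object. For the same reason a path between outer wires that never leaves \<open>f\<close> appears as
  a single dependency edge in the graph of \<open>g\<close>.
\<close>

lemma admissible_comp:
  assumes f: "admissible X Y f" and g: "admissible Y Z g"
  shows "admissible X Z (diagram_comp g f)"
  unfolding admissible_iff
proof (intro conjI ballI impI)
  have dep_Y: "(Inl (src (Win f) wi), Inr (tgt (Wout f) wo)) \<in> dep_edges Y g"
    if "wi \<in> apex (Win f)" "wo \<in> apex (Wout f)"
      "(Inl (tgt (Win f) wi), Inr (src (Wout f) wo)) \<in> (dep_edges X f)\<^sup>*" for wi wo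
    using f that unfolding admissible_iff rtrancl_eq_or_trancl by (auto intro!: dep_edgesI)
  show "is_diface X" "is_diface Z" "is_diagram X Z (diagram_comp g f)"
    using is_diagram_comp[OF admissibleD(3)[OF f] admissibleD(3)[OF g]] admissibleD[OF f] admissibleD[OF g]
    by auto
  show "acyclic (dep_edges X (diagram_comp g f))"
  proof (rule acyclicI, rule allI, rule notI)
    fix u assume "(u, u) \<in> (dep_edges X (diagram_comp g f))\<^sup>+"
    from dep_edges_comp_trancl[OF f this] show False
    proof
      assume "(u, u) \<in> (dep_edges X f)\<^sup>+"
      then show False
        using f unfolding admissible_iff acyclic_def by blast
    next
      assume "\<exists>wo\<in>apex (Wout f). \<exists>wi\<in>apex (Win f).
        (u, Inr (src (Wout f) wo)) \<in> (dep_edges X f)\<^sup>* \<and>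
        (Inr (tgt (Wout f) wo), Inl (src (Win f) wi)) \<in> (dep_edges Y g)\<^sup>+ \<and>
        (Inl (tgt (Win f) wi), u) \<in> (dep_edges X f)\<^sup>*"
      then obtain wo wi where w: "wo \<in> apex (Wout f)" "wi \<in> apex (Win f)"
        "(Inr (tgt (Wout f) wo), Inl (src (Win f) wi)) \<in> (dep_edges Y g)\<^sup>+"
        "(Inl (tgt (Win f) wi), Inr (src (Wout f) wo)) \<in> (dep_edges X f)\<^sup>*"
        by (blast intro: rtrancl_trans)
      from w(3) dep_Y[OF w(2) w(1) w(4)]
      have "(Inr (tgt (Wout f) wo), Inr (tgt (Wout f) wo)) \<in> (dep_edges Y g)\<^sup>+"
        by (rule trancl_into_trancl)
      then show False
        using g unfolding admissible_iff acyclic_def by blast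
    qed
  qed
  fix v w assume vw: "v \<in> apex (Win (diagram_comp g f))" "w \<in> apex (Wout (diagram_comp g f))"
    and path: "(Inl (tgt (Win (diagram_comp g f)) v), Inr (src (Wout (diagram_comp g f)) w))
      \<in> (dep_edges X (diagram_comp g f))\<^sup>+"
  from vw(1) obtain vg vf where v: "v = Pr vg vf" "vg \<in> apex (Win g)" "vf \<in> apex (Win f)"
      "tgt (Win g) vg = src (Win f) vf"
    unfolding diagram_comp_def span_comp_def by auto
  from vw(2) obtain wf wg where w: "w = Pr wf wg" "wf \<in> apex (Wout f)" "wg \<in> apex (Wout g)"
      "tgt (Wout f) wf = src (Wout g) wg"
    unfolding diagram_comp_def span_comp_def by auto
  have "(Inl (tgt (Win f) vf), Inr (src (Wout f) wf)) \<in> (dep_edges X (diagram_comp g f))\<^sup>+"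
    using path v w by (simp add: diagram_comp_def span_comp_def)
  from dep_edges_comp_trancl[OF f this]
  have "(Inl (src (Win f) vf), Inr (tgt (Wout f) wf)) \<in> (dep_edges Y g)\<^sup>+"
  proof
    assume "(Inl (tgt (Win f) vf), Inr (src (Wout f) wf)) \<in> (dep_edges X f)\<^sup>+"
    then show ?thesis
      using dep_Y[of vf wf] v w by (auto intro: trancl_into_rtrancl)
  next
    assume "\<exists>wo\<in>apex (Wout f). \<exists>wi\<in>apex (Win f).
      (Inl (tgt (Win f) vf), Inr (src (Wout f) wo)) \<in> (dep_edges X f)\<^sup>* \<and>
      (Inr (tgt (Wout f) wo), Inl (src (Win f) wi)) \<in> (dep_edges Y g)\<^sup>+ \<and>
      (Inl (tgt (Win f) wi), Inr (src (Wout f) wf)) \<in> (dep_edges X f)\<^sup>*"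
    then obtain wo wi where ww: "wo \<in> apex (Wout f)" "wi \<in> apex (Win f)"
      and first: "(Inl (tgt (Win f) vf), Inr (src (Wout f) wo)) \<in> (dep_edges X f)\<^sup>*"
      and mid: "(Inr (tgt (Wout f) wo), Inl (src (Win f) wi)) \<in> (dep_edges Y g)\<^sup>+"
      and last: "(Inl (tgt (Win f) wi), Inr (src (Wout f) wf)) \<in> (dep_edges X f)\<^sup>*"
      by blast
    from mid dep_Y[OF v(3) ww(1) first] dep_Y[OF ww(2) w(2) last] show ?thesis
      by (meson trancl_into_trancl trancl_into_trancl2)
  qed
  then show "(src (Win (diagram_comp g f)) v, tgt (Wout (diagram_comp g f)) w) \<in> dep Z"
    using g v w unfolding admissible_iff by (simp add: diagram_comp_def span_comp_def)
qed

subsection \<open>Parallel diagrams\<close>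

lemma is_diface_tensor: "is_diface X \<Longrightarrow> is_diface Y \<Longrightarrow> is_diface (tensor_obj X Y)"
  unfolding is_diface_def tensor_obj_def by auto

lemma is_diagram_par:
  assumes "is_diagram X X' f" "is_diagram Y Y' g"
  shows "is_diagram (tensor_obj X Y) (tensor_obj X' Y') (diagram_par f g)"
  using assms unfolding is_diagram_def diagram_par_def tensor_obj_def by (auto intro: is_span_par)

lemma dep_edges_par:
  "dep_edges (tensor_obj X Y) (diagram_par f g)
    = map_prod (map_sum InL InL) (map_sum InL InL) ` dep_edges X f
    \<union> map_prod (map_sum InR InR) (map_sum InR InR) ` dep_edges Y g"
  unfolding dep_edges_def tensor_obj_def diagram_par_def span_par_def dunion_def
  by (simp add: image_Un image_image case_prod_unfold Un_ac)

lemma trancl_disjoint_images: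
  assumes "inj p" "inj q" "range p \<inter> range q = {}"
    and "(u, v) \<in> (map_prod p p ` E \<union> map_prod q q ` E')\<^sup>+"
  shows "(\<exists>u' v'. u = p u' \<and> v = p v' \<and> (u', v') \<in> E\<^sup>+)
    \<or> (\<exists>u' v'. u = q u' \<and> v = q v' \<and> (u', v') \<in> E'\<^sup>+)"
  using assms(4)
proof (induction rule: trancl_induct)
  case (base v)
  then have "(\<exists>a b. u = p a \<and> v = p b \<and> (a, b) \<in> E) \<or> (\<exists>a b. u = q a \<and> v = q b \<and> (a, b) \<in> E')"
    by auto
  then show ?case
    by (blast intro: r_into_trancl)
next
  case (step v z)
  have pq: "p a \<noteq> q b" for a b
    using assms(3) by auto
  have pp: "p a = p b \<longleftrightarrow> a = b" and qq: "q a' = q b' \<longleftrightarrow> a' = b'" for a b a' b'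
    using assms(1,2) by (auto dest: injD)
  from step.hyps(2) consider
      (p) c d where "v = p c" "z = p d" "(c, d) \<in> E"
    | (q) c d where "v = q c" "z = q d" "(c, d) \<in> E'"
    by auto
  then show ?case
  proof cases
    case p
    with step.IH pq obtain a where "u = p a" "(a, c) \<in> E\<^sup>+"
      unfolding p(1) pp by blast
    with p show ?thesis
      by (blast intro: trancl_into_trancl)
  next
    case q
    with step.IH pq[symmetric] obtain a where "u = q a" "(a, c) \<in> E'\<^sup>+"
      unfolding q(1) qq by blast
    with q show ?thesis
      by (blast intro: trancl_into_trancl)
  qed
qed

lemma Inl_eq_map_sum: "Inl y = map_sum p q u \<longleftrightarrow> (\<exists>x. u = Inl x \<and> y = p x)"
  by (cases u) auto

lemma Inr_eq_map_sum: "Inr y = map_sum p q u \<longleftrightarrow> (\<exists>x. u = Inr x \<and> y = q x)"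
  by (cases u) auto

lemma inj_InL_InR: "inj InL" "inj InR"
  by (simp_all add: inj_def)

text \<open>
  The graph of a parallel diagram is the disjoint union of two graphs, so no path crosses from one
  side to the other.
\<close>

lemma dep_edges_par_trancl:
  assumes "(u, v) \<in> (dep_edges (tensor_obj X Y) (diagram_par f g))\<^sup>+"
  shows "(\<exists>u' v'. u = map_sum InL InL u' \<and> v = map_sum InL InL v' \<and> (u', v') \<in> (dep_edges X f)\<^sup>+)
    \<or> (\<exists>u' v'. u = map_sum InR InR u' \<and> v = map_sum InR InR v' \<and> (u', v') \<in> (dep_edges Y g)\<^sup>+)"
proof (rule trancl_disjoint_images)
  have "map_sum InL InL a \<noteq> map_sum InR InR b" for a b :: "'a univ + 'a univ"
    by (cases a; cases b) auto
  then show "range (map_sum InL InL) \<inter> range (map_sum InR InR :: 'a univ + 'a univ \<Rightarrow> _) = {}"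
    by auto
  show "inj (map_sum InL InL)" "inj (map_sum InR InR)"
    by (simp_all add: sum.inj_map inj_InL_InR)
qed (use assms in \<open>simp add: dep_edges_par\<close>)

lemma admissible_par:
  assumes f: "admissible X X' f" and g: "admissible Y Y' g"
  shows "admissible (tensor_obj X Y) (tensor_obj X' Y') (diagram_par f g)"
  unfolding admissible_iff
proof (intro conjI ballI impI)
  show "is_diface (tensor_obj X Y)" "is_diface (tensor_obj X' Y')"
    "is_diagram (tensor_obj X Y) (tensor_obj X' Y') (diagram_par f g)"
    by (simp_all only: is_diface_tensor is_diagram_par admissibleD[OF f] admissibleD[OF g])
  show "acyclic (dep_edges (tensor_obj X Y) (diagram_par f g))"
  proof (rule acyclicI, rule allI, rule notI)
    fix u assume "(u, u) \<in> (dep_edges (tensor_obj X Y) (diagram_par f g))\<^sup>+"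
    from dep_edges_par_trancl[OF this] show False
    proof (elim disjE exE conjE)
      fix a b assume "u = map_sum InL InL a" "u = map_sum InL InL b" and ab: "(a, b) \<in> (dep_edges X f)\<^sup>+"
      then have "a = b"
        using injD[OF sum.inj_map[OF inj_InL_InR(1) inj_InL_InR(1)]] by metis
      with ab f show False
        unfolding admissible_iff acyclic_def by simp
    next
      fix a b assume "u = map_sum InR InR a" "u = map_sum InR InR b" and ab: "(a, b) \<in> (dep_edges Y g)\<^sup>+"
      then have "a = b"
        using injD[OF sum.inj_map[OF inj_InL_InR(2) inj_InL_InR(2)]] by metis
      with ab g show False
        unfolding admissible_iff acyclic_def by simp
    qed
  qed
  fix v w
  assume v: "v \<in> apex (Win (diagram_par f g))" and w: "w \<in> apex (Wout (diagram_par f g))"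
    and path: "(Inl (tgt (Win (diagram_par f g)) v), Inr (src (Wout (diagram_par f g)) w))
      \<in> (dep_edges (tensor_obj X Y) (diagram_par f g))\<^sup>+"
  have dep_f: "(src (Win f) a, tgt (Wout f) b) \<in> dep X'"
    if "a \<in> apex (Win f)" "b \<in> apex (Wout f)"
      "(Inl (tgt (Win f) a), Inr (src (Wout f) b)) \<in> (dep_edges X f)\<^sup>+" for a b
    using f that unfolding admissible_iff by blast
  have dep_g: "(src (Win g) a, tgt (Wout g) b) \<in> dep Y'"
    if "a \<in> apex (Win g)" "b \<in> apex (Wout g)"
      "(Inl (tgt (Win g) a), Inr (src (Wout g) b)) \<in> (dep_edges Y g)\<^sup>+" for a b
    using g that unfolding admissible_iff by blast
  have "(\<exists>a. v = InL a \<and> a \<in> apex (Win f)) \<or> (\<exists>a. v = InR a \<and> a \<in> apex (Win g))"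
    using v unfolding diagram_par_def span_par_def dunion_def by auto
  moreover have "(\<exists>b. w = InL b \<and> b \<in> apex (Wout f)) \<or> (\<exists>b. w = InR b \<and> b \<in> apex (Wout g))"
    using w unfolding diagram_par_def span_par_def dunion_def by auto
  ultimately show "(src (Win (diagram_par f g)) v, tgt (Wout (diagram_par f g)) w) \<in> dep (tensor_obj X' Y')"
    using dep_edges_par_trancl[OF path]
    by (elim disjE exE conjE; simp add: diagram_par_def span_par_def tensor_obj_def
        Inl_eq_map_sum Inr_eq_map_sum; use dep_f dep_g in \<open>force\<close>)
qed

subsection \<open>Relabellings\<close>

lemma is_diagram_relabel:
  assumes "is_diface X" "h \<in> inp X \<rightarrow> inp Y" "h \<in> outp X \<rightarrow> outp Y"
  shows "is_diagram X Y (relabel X h)"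
  using assms unfolding is_diagram_def is_span_def relabel_def is_diface_def by auto

definition preserves_dep :: "'a univ diface \<Rightarrow> 'a univ diface \<Rightarrow> ('a univ \<Rightarrow> 'a univ) \<Rightarrow> bool" where
  "preserves_dep X Y h \<longleftrightarrow> is_diface X \<and> is_diface Y \<and> h \<in> inp X \<rightarrow> inp Y \<and> h \<in> outp X \<rightarrow> outp Y \<and>
     map_prod h h ` dep X \<subseteq> dep Y"

lemma admissible_relabel:
  assumes "preserves_dep X Y h"
  shows "admissible X Y (relabel X h)"
proof -
  have path: "\<exists>i j. u = Inl i \<and> v = Inr j \<and> (i, j) \<in> dep X"
    if "(u, v) \<in> (dep_edges X (relabel X h))\<^sup>+" for u v
    using that by (induction rule: trancl_induct) (auto simp: dep_edges_def relabel_def)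
  have "acyclic (dep_edges X (relabel X h))"
    unfolding acyclic_def using path by blast
  moreover have "(h i, h j) \<in> dep Y" if "(Inl i, Inr j) \<in> (dep_edges X (relabel X h))\<^sup>+" for i j
    using path[OF that] assms unfolding preserves_dep_def by auto
  ultimately show ?thesis
    using assms unfolding admissible_iff
    by (auto simp: is_diagram_relabel preserves_dep_def) (auto simp: relabel_def)
qed

section \<open>The monoidal category of wiring diagrams\<close>

lemma diagram_eq_equiv: "equiv UNIV diagram_eq"
proof (rule equivI)
  show "refl diagram_eq"
    by (auto simp: refl_on_def diagram_eq_def intro: span_iso_refl)
  show "sym diagram_eq"
    by (auto simp: sym_def diagram_eq_def intro: span_iso_sym)
  show "trans diagram_eq"
    unfolding trans_def diagram_eq_def by (blast intro: span_iso_trans)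
qed simp

definition mor :: "'a univ diface \<Rightarrow> 'a univ diface \<Rightarrow> 'a diagram \<Rightarrow> 'a wmor" where
  "mor X Y f = \<lparr>wdom = X, wcod = Y, wiring = diagram_class f\<rparr>"

lemma diagram_class_eq_iff: "diagram_class f = diagram_class g \<longleftrightarrow> (f, g) \<in> diagram_eq"
  unfolding diagram_class_def using eq_equiv_class_iff[OF diagram_eq_equiv] by simp

lemma mor_eq_iff: "mor X Y f = mor X Y g \<longleftrightarrow> (f, g) \<in> diagram_eq"
  by (simp add: mor_def diagram_class_eq_iff)

lemma mem_diagram_class: "g \<in> diagram_class f \<longleftrightarrow> (f, g) \<in> diagram_eq"
  unfolding diagram_class_def by simp

lemma diagram_eq_refl: "(f, f) \<in> diagram_eq"
  by (simp add: diagram_eq_def span_iso_refl)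

lemma is_diagram_diagram_eq: "(f, g) \<in> diagram_eq \<Longrightarrow> is_diagram X Y f \<Longrightarrow> is_diagram X Y g"
  unfolding is_diagram_def diagram_eq_def by (auto intro: is_span_iso)

definition in_map :: "'a univ diface \<Rightarrow> 'a diagram \<Rightarrow> 'a vec \<Rightarrow> 'a vec" where
  "in_map X f = span_map (inp X) (Win f)"

definition tr_map :: "'a univ diface \<Rightarrow> 'a diagram \<Rightarrow> 'a vec \<Rightarrow> 'a vec" where
  "tr_map X f = span_map (inp X) (Wtr f)"

definition out_map :: "'a univ diface \<Rightarrow> 'a diagram \<Rightarrow> 'a vec \<Rightarrow> 'a vec" where
  "out_map Y f = span_map (outp Y) (Wout f)"

lemma wire_maps_RR [simp]:
  "in_map X f y \<in> RR (inp X)" "tr_map X f x \<in> RR (inp X)" "out_map Y f x \<in> RR (outp Y)"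
  by (simp_all add: in_map_def tr_map_def out_map_def)

lemma diagram_eq_imp_maps:
  assumes "(f, g) \<in> diagram_eq"
  shows "in_map X f = in_map X g" "tr_map X f = tr_map X g" "out_map Y f = out_map Y g"
  using assms unfolding diagram_eq_def in_map_def tr_map_def out_map_def
  by (auto intro: span_iso_imp_map_eq)

lemma diagram_eqI:
  assumes "is_diagram X Y f" "is_diagram X Y g"
    and "\<And>y. y \<in> RR (inp Y) \<Longrightarrow> in_map X f y = in_map X g y"
    and "\<And>x. x \<in> RR (outp X) \<Longrightarrow> tr_map X f x = tr_map X g x"
    and "\<And>x. x \<in> RR (outp X) \<Longrightarrow> out_map Y f x = out_map Y g x"
  shows "(f, g) \<in> diagram_eq"
  using assms unfolding is_diagram_def in_map_def tr_map_def out_map_def diagram_eq_def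
  by (auto intro: map_eq_imp_span_iso)

text \<open>
  Substituting one diagram into another composes the linear maps of the input and output wires;
  a trace wire of the composite is either an inner trace wire or an outer one, reached through
  the output wires and left through the input wires of the inner diagram.
\<close>

lemma wire_maps_comp:
  assumes f: "is_diagram X Y f" and g: "is_diagram Y Z g"
  shows "in_map X (diagram_comp g f) z = in_map X f (in_map Y g z)"
    and "tr_map X (diagram_comp g f) x
      = vadd (inp X) (tr_map X f x) (in_map X f (tr_map Y g (out_map Y f x)))"
    and "out_map Z (diagram_comp g f) x = out_map Z g (out_map Y f x)"
proof -
  note spans = f[unfolded is_diagram_def] g[unfolded is_diagram_def]
  show "in_map X (diagram_comp g f) z = in_map X f (in_map Y g z)"
    using spans unfolding in_map_def diagram_comp_def by (auto intro: span_map_comp)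
  show "out_map Z (diagram_comp g f) x = out_map Z g (out_map Y f x)"
    using spans unfolding out_map_def diagram_comp_def by (auto intro: span_map_comp)
  have inner: "is_span (outp Y) (inp X) (span_comp (Wtr g) (Win f))"
    using spans by (auto intro: is_span_comp)
  then have "is_span (outp X) (inp X) (span_comp (Wout f) (span_comp (Wtr g) (Win f)))"
    using spans by (auto intro: is_span_comp)
  then have "span_map (inp X) (span_add (Wtr f) (span_comp (Wout f) (span_comp (Wtr g) (Win f)))) x
      = vadd (inp X) (span_map (inp X) (Wtr f) x)
          (span_map (inp X) (span_comp (Wout f) (span_comp (Wtr g) (Win f))) x)"
    using spans by (intro span_map_add) auto
  moreover have "span_map (inp X) (span_comp (Wout f) (span_comp (Wtr g) (Win f))) x
      = span_map (inp X) (span_comp (Wtr g) (Win f)) (span_map (outp Y) (Wout f) x)"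
    using spans inner by (intro span_map_comp) auto
  moreover have "\<dots> = span_map (inp X) (Win f) (span_map (inp Y) (Wtr g) (span_map (outp Y) (Wout f) x))"
    using spans by (intro span_map_comp) auto
  ultimately show "tr_map X (diagram_comp g f) x
      = vadd (inp X) (tr_map X f x) (in_map X f (tr_map Y g (out_map Y f x)))"
    unfolding tr_map_def in_map_def out_map_def diagram_comp_def by simp
qed

lemma tensor_obj_sel [simp]:
  "inp (tensor_obj X Y) = dunion (inp X) (inp Y)"
  "outp (tensor_obj X Y) = dunion (outp X) (outp Y)"
  by (simp_all add: tensor_obj_def)

lemma wire_maps_par:
  assumes f: "is_diagram X X' f" and g: "is_diagram Y Y' g"
  shows "in_map (tensor_obj X Y) (diagram_par f g) y = join_vec (inp X) (inp Y)
      (in_map X f (pull (inp X') InL y), in_map Y g (pull (inp Y') InR y))"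
    and "tr_map (tensor_obj X Y) (diagram_par f g) x = join_vec (inp X) (inp Y)
      (tr_map X f (pull (outp X) InL x), tr_map Y g (pull (outp Y) InR x))"
    and "out_map (tensor_obj X' Y') (diagram_par f g) x = join_vec (outp X') (outp Y')
      (out_map X' f (pull (outp X) InL x), out_map Y' g (pull (outp Y) InR x))"
  using f g unfolding in_map_def tr_map_def out_map_def diagram_par_def is_diagram_def
  by (simp_all add: span_map_par)

definition zero_vec :: "'p set \<Rightarrow> 'p \<Rightarrow> real" where
  "zero_vec A = (\<lambda>a\<in>A. 0)"

lemma restrict_RR [simp]: "restrict x A \<in> RR A"
  unfolding RR_def by auto

lemma zero_vec_RR [simp]: "zero_vec A \<in> RR A"
  by (simp add: zero_vec_def)

lemma vadd_zero:
  "x \<in> RR A \<Longrightarrow> vadd A x (zero_vec A) = x"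
  "x \<in> RR A \<Longrightarrow> vadd A (zero_vec A) x = x"
  by (auto intro!: RR_eqI[where A = A] simp: vadd_apply zero_vec_def)

lemma in_map_vadd:
  assumes "is_diagram X Y f"
  shows "in_map X f (vadd (inp Y) x y) = vadd (inp X) (in_map X f x) (in_map X f y)"
  using assms unfolding in_map_def is_diagram_def by (auto intro: span_map_vadd)

lemma in_map_zero:
  assumes "is_diagram X Y f"
  shows "in_map X f (zero_vec (inp Y)) = zero_vec (inp X)"
  using assms unfolding in_map_def is_diagram_def is_span_def
  by (intro RR_eqI[where A = "inp X"]) (auto simp: span_map_apply zero_vec_def intro!: sum.neutral)

lemma wire_maps_relabel:
  "in_map X (relabel X h) y = pull (inp X) h y"
  "tr_map X (relabel X h) x = zero_vec (inp X)"
  "out_map Y (relabel X h) x = push (outp X) h (outp Y) x"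
proof -
  show "in_map X (relabel X h) y = pull (inp X) h y"
  proof (rule RR_eqI[where A = "inp X"])
    fix a assume a: "a \<in> inp X"
    then have "{w \<in> inp X. w = a} = {a}"
      by auto
    with a show "in_map X (relabel X h) y a = pull (inp X) h y a"
      by (simp add: in_map_def relabel_def span_map_apply pull_apply)
  qed auto
  show "tr_map X (relabel X h) x = zero_vec (inp X)"
    by (rule RR_eqI[where A = "inp X"]) (auto simp: tr_map_def relabel_def span_map_apply zero_vec_def)
  show "out_map Y (relabel X h) x = push (outp X) h (outp Y) x"
    by (rule RR_eqI[where A = "outp Y"]) (auto simp: out_map_def relabel_def span_map_apply push_def)
qed

subsection \<open>Morphisms and their representatives\<close>

text \<open>
  The next two lemmas show that composition and tensor product do not depend on representatives:
  the linear maps of the result are functions of the linear maps of the factors.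
\<close>

lemma wcomp_mor:
  assumes f: "is_diagram X Y f" and g: "is_diagram Y Z g"
  shows "wcomp (mor Y Z g) (mor X Y f) = mor X Z (diagram_comp g f)"
proof -
  have "diagram_class (diagram_comp g' f') = diagram_class (diagram_comp g f)"
    if "(g, g') \<in> diagram_eq" "(f, f') \<in> diagram_eq" for f' g'
  proof -
    have "is_diagram X Y f'" "is_diagram Y Z g'"
      using f g that by (auto intro: is_diagram_diagram_eq)
    then have "(diagram_comp g' f', diagram_comp g f) \<in> diagram_eq"
      using f g diagram_eq_imp_maps[OF that(1)] diagram_eq_imp_maps[OF that(2)]
      by (intro diagram_eqI[of X Z]) (simp_all add: wire_maps_comp is_diagram_comp)
    then show ?thesis
      by (simp add: diagram_class_eq_iff)
  qed
  then have "(\<Union>g'\<in>diagram_class g. \<Union>f'\<in>diagram_class f. diagram_class (diagram_comp g' f'))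
      = diagram_class (diagram_comp g f)"
    using diagram_eq_refl by (fastforce simp: mem_diagram_class)
  then show ?thesis
    by (simp add: wcomp_def mor_def)
qed

lemma tensor_mor_mor:
  assumes f: "is_diagram X X' f" and g: "is_diagram Y Y' g"
  shows "tensor_mor (mor X X' f) (mor Y Y' g)
    = mor (tensor_obj X Y) (tensor_obj X' Y') (diagram_par f g)"
proof -
  have "diagram_class (diagram_par f' g') = diagram_class (diagram_par f g)"
    if "(f, f') \<in> diagram_eq" "(g, g') \<in> diagram_eq" for f' g'
  proof -
    have "is_diagram X X' f'" "is_diagram Y Y' g'"
      using f g that by (auto intro: is_diagram_diagram_eq)
    then have "(diagram_par f' g', diagram_par f g) \<in> diagram_eq"
      using f g diagram_eq_imp_maps[OF that(1)] diagram_eq_imp_maps[OF that(2)]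
      by (intro diagram_eqI[of "tensor_obj X Y" "tensor_obj X' Y'"])
        (simp_all add: wire_maps_par is_diagram_par del: tensor_obj_sel)
    then show ?thesis
      by (simp add: diagram_class_eq_iff)
  qed
  then have "(\<Union>f'\<in>diagram_class f. \<Union>g'\<in>diagram_class g. diagram_class (diagram_par f' g'))
      = diagram_class (diagram_par f g)"
    using diagram_eq_refl by (fastforce simp: mem_diagram_class)
  then show ?thesis
    by (simp add: tensor_mor_def mor_def)
qed

lemma Hom_dDWD_iff: "F \<in> Hom dDWD X Y \<longleftrightarrow> (\<exists>f. admissible X Y f \<and> F = mor X Y f)"
  unfolding Hom_def dDWD_def ddwd_mors_def admissible_def mor_def by auto

lemma Ar_dDWD_iff: "F \<in> Ar dDWD \<longleftrightarrow> (\<exists>X Y f. admissible X Y f \<and> F = mor X Y f)"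
  unfolding dDWD_def ddwd_mors_def admissible_def mor_def by auto

lemma admissible_mor_Hom: "admissible X Y f \<Longrightarrow> mor X Y f \<in> Hom dDWD X Y"
  unfolding Hom_dDWD_iff by blast

subsection \<open>Calculus of relabellings\<close>

text \<open>
  Relabellings compose and tensor like the underlying functions on ports. Therefore the pentagon,
  the triangle and the invertibility of the structure morphisms reduce to equations between
  functions, which hold by inspection of the ports.
\<close>

lemma relabel_cong:
  assumes "\<And>p. p \<in> inp X \<union> outp X \<Longrightarrow> h p = k p"
  shows "mor X Y (relabel X h) = mor X Y (relabel X k)"
  unfolding mor_eq_iff diagram_eq_def span_iso_def relabel_def
  using assms by (auto intro!: exI[of _ id])

lemma relabel_comp:
  assumes "preserves_dep X Y h" "preserves_dep Y Z k"
  shows "wcomp (mor Y Z (relabel Y k)) (mor X Y (relabel X h)) = mor X Z (relabel X (k \<circ> h))"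
proof -
  have "span_iso (Win (relabel X (k \<circ> h))) (Win (diagram_comp (relabel Y k) (relabel X h)))"
    unfolding span_iso_def using assms
    by (intro exI[of _ "\<lambda>p. Pr (h p) p"])
      (auto simp: bij_betw_def inj_on_def relabel_def diagram_comp_def span_comp_def preserves_dep_def)
  moreover have "span_iso (Wtr (relabel X (k \<circ> h))) (Wtr (diagram_comp (relabel Y k) (relabel X h)))"
    unfolding span_iso_def
    by (auto simp: bij_betw_def relabel_def diagram_comp_def span_comp_def span_add_def dunion_def)
  moreover have "span_iso (Wout (relabel X (k \<circ> h))) (Wout (diagram_comp (relabel Y k) (relabel X h)))"
    unfolding span_iso_def using assms
    by (intro exI[of _ "\<lambda>p. Pr p (h p)"])
      (auto simp: bij_betw_def inj_on_def relabel_def diagram_comp_def span_comp_def preserves_dep_def)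
  ultimately have "(relabel X (k \<circ> h), diagram_comp (relabel Y k) (relabel X h)) \<in> diagram_eq"
    unfolding diagram_eq_def by blast
  moreover have "is_diagram X Y (relabel X h)" "is_diagram Y Z (relabel Y k)"
    using assms by (auto simp: preserves_dep_def intro: is_diagram_relabel)
  ultimately show ?thesis
    by (metis wcomp_mor mor_eq_iff)
qed

lemma relabel_tensor:
  assumes "preserves_dep X X' h" "preserves_dep Y Y' k"
  shows "tensor_mor (mor X X' (relabel X h)) (mor Y Y' (relabel Y k))
    = mor (tensor_obj X Y) (tensor_obj X' Y') (relabel (tensor_obj X Y) (copair (InL \<circ> h) (InR \<circ> k)))"
proof -
  have "(diagram_par (relabel X h) (relabel Y k), relabel (tensor_obj X Y) (copair (InL \<circ> h) (InR \<circ> k)))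
      \<in> diagram_eq"
    unfolding diagram_eq_def span_iso_def diagram_par_def span_par_def relabel_def
    by (auto simp: dunion_def intro!: exI[of _ id])
  moreover have "is_diagram X X' (relabel X h)" "is_diagram Y Y' (relabel Y k)"
    using assms by (auto simp: preserves_dep_def intro: is_diagram_relabel)
  ultimately show ?thesis
    by (simp add: tensor_mor_mor mor_eq_iff)
qed

lemma preserves_dep_id: "is_diface X \<Longrightarrow> preserves_dep X X id"
  unfolding preserves_dep_def by (auto simp: map_prod_def)

lemma preserves_dep_comp:
  assumes "preserves_dep X Y h" "preserves_dep Y Z k"
  shows "preserves_dep X Z (k \<circ> h)"
proof -
  have "map_prod (k \<circ> h) (k \<circ> h) ` dep X = map_prod k k ` map_prod h h ` dep X"
    by (simp add: image_image map_prod_def case_prod_unfold)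
  then show ?thesis
    using assms unfolding preserves_dep_def by (auto simp: Pi_iff) blast
qed

lemma dep_tensor_iff [simp]:
  "(InL i, InL j) \<in> dep (tensor_obj X Y) \<longleftrightarrow> (i, j) \<in> dep X"
  "(InR i, InR j) \<in> dep (tensor_obj X Y) \<longleftrightarrow> (i, j) \<in> dep Y"
  "(InL i, InR j) \<notin> dep (tensor_obj X Y)"
  "(InR i, InL j) \<notin> dep (tensor_obj X Y)"
  by (auto simp: tensor_obj_def)

lemma dep_tensorE:
  assumes "(u, v) \<in> dep (tensor_obj X Y)"
  obtains i j where "u = InL i" "v = InL j" "(i, j) \<in> dep X"
    | i j where "u = InR i" "v = InR j" "(i, j) \<in> dep Y"
  using assms by (auto simp: tensor_obj_def)

lemma preserves_dep_tensor:
  assumes "preserves_dep X X' h" "preserves_dep Y Y' k"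
  shows "preserves_dep (tensor_obj X Y) (tensor_obj X' Y') (copair (InL \<circ> h) (InR \<circ> k))"
  using assms unfolding preserves_dep_def
  by (auto simp: is_diface_tensor dunion_def elim!: dep_tensorE)

text \<open>
  The inverse is carried along explicitly because pushing a vector forward along a bijection is the
  same as pulling it back along the inverse. With this, only pullbacks occur in computations.
\<close>

definition port_iso :: "'a univ diface \<Rightarrow> 'a univ diface \<Rightarrow> ('a univ \<Rightarrow> 'a univ) \<Rightarrow> ('a univ \<Rightarrow> 'a univ)
    \<Rightarrow> bool" where
  "port_iso X Y h k \<longleftrightarrow> preserves_dep X Y h \<and> preserves_dep Y X k \<and>
     (\<forall>p\<in>inp X \<union> outp X. k (h p) = p) \<and> (\<forall>q\<in>inp Y \<union> outp Y. h (k q) = q)"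

lemma relabel_iso_Hom:
  assumes "port_iso X Y h k"
  shows "mor X Y (relabel X h) \<in> iso_Hom dDWD X Y"
proof -
  have "wcomp (mor Y X (relabel Y k)) (mor X Y (relabel X h)) = mor X X (relabel X id)"
    using assms unfolding port_iso_def by (subst relabel_comp) (auto intro!: relabel_cong)
  moreover have "wcomp (mor X Y (relabel X h)) (mor Y X (relabel Y k)) = mor Y Y (relabel Y id)"
    using assms unfolding port_iso_def by (subst relabel_comp) (auto intro!: relabel_cong)
  moreover have "mor X Y (relabel X h) \<in> Hom dDWD X Y" "mor Y X (relabel Y k) \<in> Hom dDWD Y X"
    using assms unfolding port_iso_def by (auto intro: admissible_mor_Hom admissible_relabel)
  ultimately show ?thesis
    unfolding iso_Hom_def by (auto simp: dDWD_def relabel_mor_def mor_def)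
qed

lemma push_port_iso:
  assumes "port_iso X Y h k"
  shows "push (outp X) h (outp Y) x = pull (outp Y) k x"
  using assms unfolding port_iso_def preserves_dep_def by (intro push_inverse) auto

text \<open>
  The relabelling has no trace wires, so that on both sides only the trace wires of \<open>f\<close> or \<open>g\<close>
  contribute, and naturality becomes an intertwining relation for each of the three wire maps.
\<close>

lemma relabel_natural:
  assumes f: "is_diagram X X' f" and g: "is_diagram Y Y' g"
    and iso: "port_iso X Y h k" "port_iso X' Y' h' k'"
    and in_eq: "\<And>y. y \<in> RR (inp Y') \<Longrightarrow> in_map X f (pull (inp X') h' y) = pull (inp X) h (in_map Y g y)"
    and tr_eq: "\<And>x. x \<in> RR (outp X) \<Longrightarrow>
      tr_map X f x = pull (inp X) h (tr_map Y g (pull (outp Y) k x))"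
    and out_eq: "\<And>x. x \<in> RR (outp X) \<Longrightarrow>
      pull (outp Y') k' (out_map X' f x) = out_map Y' g (pull (outp Y) k x)"
  shows "wcomp (mor X' Y' (relabel X' h')) (mor X X' f) = wcomp (mor Y Y' g) (mor X Y (relabel X h))"
proof -
  have h: "is_diagram X Y (relabel X h)" and h': "is_diagram X' Y' (relabel X' h')"
    using iso unfolding port_iso_def preserves_dep_def by (auto intro: is_diagram_relabel)
  have "(diagram_comp (relabel X' h') f, diagram_comp g (relabel X h)) \<in> diagram_eq"
    using in_eq tr_eq out_eq
    by (intro diagram_eqI[of X Y'])
      (simp_all add: is_diagram_comp[OF f h'] is_diagram_comp[OF h g] wire_maps_comp[OF f h']
        wire_maps_comp[OF h g] wire_maps_relabel in_map_zero[OF f] vadd_zero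
        push_port_iso[OF iso(1)] push_port_iso[OF iso(2)])
  then show ?thesis
    by (simp add: wcomp_mor[OF f h'] wcomp_mor[OF h g] mor_eq_iff)
qed

subsection \<open>Associator and unitors\<close>

lemma dDWD_sel [simp]:
  "Ob dDWD = {X. is_diface X}" "Dom dDWD = wdom" "Cod dDWD = wcod" "Comp dDWD = wcomp"
  "TenO dDWD = tensor_obj" "TenA dDWD = tensor_mor" "Unit dDWD = unit_obj"
  by (simp_all add: dDWD_def)

definition assoc_fun :: "'a univ \<Rightarrow> 'a univ" where
  "assoc_fun = copair (copair InL (InR \<circ> InL)) (InR \<circ> InR)"

definition assoc_inv :: "'a univ \<Rightarrow> 'a univ" where
  "assoc_inv = copair (InL \<circ> InL) (copair (InL \<circ> InR) InR)"

lemma assoc_fun_simps [simp]: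
  "assoc_fun (InL (InL p)) = InL p" "assoc_fun (InL (InR p)) = InR (InL p)"
  "assoc_fun (InR p) = InR (InR p)"
  by (simp_all add: assoc_fun_def)

lemma assoc_inv_simps [simp]:
  "assoc_inv (InL p) = InL (InL p)" "assoc_inv (InR (InL p)) = InL (InR p)"
  "assoc_inv (InR (InR p)) = InR p"
  by (simp_all add: assoc_inv_def)

lemma dDWD_structure:
  "Idt dDWD X = mor X X (relabel X id)"
  "Assoc dDWD X Y Z = mor (tensor_obj (tensor_obj X Y) Z) (tensor_obj X (tensor_obj Y Z))
     (relabel (tensor_obj (tensor_obj X Y) Z) assoc_fun)"
  "Lunit dDWD X = mor (tensor_obj unit_obj X) X (relabel (tensor_obj unit_obj X) (copair id id))"
  "Runit dDWD X = mor (tensor_obj X unit_obj) X (relabel (tensor_obj X unit_obj) (copair id id))"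
  by (simp_all add: dDWD_def relabel_mor_def mor_def assoc_fun_def)

lemma unit_obj_sel [simp]: "inp unit_obj = {}" "outp unit_obj = {}" "dep unit_obj = {}"
  by (simp_all add: unit_obj_def)

lemma is_diface_unit: "is_diface unit_obj"
  by (simp add: is_diface_def)

lemma dunionE:
  assumes "i \<in> dunion A B"
  obtains a where "i = InL a" "a \<in> A" | b where "i = InR b" "b \<in> B"
  using assms unfolding dunion_def by auto

lemma port_iso_assoc:
  assumes "is_diface X" "is_diface Y" "is_diface Z"
  shows "port_iso (tensor_obj (tensor_obj X Y) Z) (tensor_obj X (tensor_obj Y Z)) assoc_fun assoc_inv"
  using assms unfolding port_iso_def preserves_dep_def
  by (auto simp: is_diface_tensor elim!: dunionE dep_tensorE)

lemma port_iso_lunit: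
  assumes "is_diface X"
  shows "port_iso (tensor_obj unit_obj X) X (copair id id) InR"
  using assms unfolding port_iso_def preserves_dep_def
  by (auto simp: is_diface_tensor is_diface_unit elim!: dunionE dep_tensorE)

lemma port_iso_runit:
  assumes "is_diface X"
  shows "port_iso (tensor_obj X unit_obj) X (copair id id) InL"
  using assms unfolding port_iso_def preserves_dep_def
  by (auto simp: is_diface_tensor is_diface_unit elim!: dunionE dep_tensorE)

lemma pull_cong: "(\<And>a. a \<in> A \<Longrightarrow> x (f a) = y (g a)) \<Longrightarrow> pull A f x = pull A g y"
  by (auto intro!: RR_eqI[where A = A] simp: pull_apply)

lemma join_assoc:
  "pull (dunion (dunion A B) C) assoc_fun (join_vec A (dunion B C) (x, join_vec B C (y, z)))
    = join_vec (dunion A B) C (join_vec A B (x, y), z)"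
  "pull (dunion A (dunion B C)) assoc_inv (join_vec (dunion A B) C (join_vec A B (x, y), z))
    = join_vec A (dunion B C) (x, join_vec B C (y, z))"
  by (rule RR_eqI[where A = "dunion (dunion A B) C"] RR_eqI[where A = "dunion A (dunion B C)"];
      auto simp: pull_apply join_vec_apply elim!: dunionE)+

lemma split_assoc_fun:
  "pull A InL (pull (dunion A B) InL (pull (dunion (dunion A B) C) assoc_fun y)) = pull A InL y"
  "pull B InR (pull (dunion A B) InL (pull (dunion (dunion A B) C) assoc_fun y))
    = pull B InL (pull (dunion B C) InR y)"
  "pull C InR (pull (dunion (dunion A B) C) assoc_fun y) = pull C InR (pull (dunion B C) InR y)"
  by (auto simp: pull_apply intro!: pull_cong)

lemma split_assoc_inv:
  "pull A InL (pull (dunion A (dunion B C)) assoc_inv x) = pull A InL (pull (dunion A B) InL x)"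
  "pull B InL (pull (dunion B C) InR (pull (dunion A (dunion B C)) assoc_inv x))
    = pull B InR (pull (dunion A B) InL x)"
  "pull C InR (pull (dunion B C) InR (pull (dunion A (dunion B C)) assoc_inv x)) = pull C InR x"
  by (auto simp: pull_apply intro!: pull_cong)

lemma join_empty:
  "join_vec {} A (x, y) = pull (dunion {} A) (copair id id) y"
  "join_vec A {} (y, x) = pull (dunion A {}) (copair id id) y"
  by (rule RR_eqI[where A = "dunion {} A"] RR_eqI[where A = "dunion A {}"];
      auto simp: pull_apply join_vec_apply elim!: dunionE)+

lemma split_codiagonal:
  assumes "y \<in> RR A"
  shows "pull A InR (pull (dunion {} A) (copair id id) y) = y"
    "pull A InL (pull (dunion A {}) (copair id id) y) = y"
  using assms by (auto intro!: RR_eqI[where A = A] simp: pull_apply)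

lemma assoc_natural:
  assumes f: "admissible X X' f" and g: "admissible Y Y' g" and h: "admissible Z Z' h"
  shows "wcomp (Assoc dDWD X' Y' Z') (tensor_mor (tensor_mor (mor X X' f) (mor Y Y' g)) (mor Z Z' h))
    = wcomp (tensor_mor (mor X X' f) (tensor_mor (mor Y Y' g) (mor Z Z' h))) (Assoc dDWD X Y Z)"
proof -
  note d = admissibleD(3)[OF f] admissibleD(3)[OF g] admissibleD(3)[OF h]
  note fg = is_diagram_par[OF d(1) d(2)] and gh = is_diagram_par[OF d(2) d(3)]
  show ?thesis
    unfolding dDWD_structure tensor_mor_mor[OF d(1) d(2)] tensor_mor_mor[OF d(2) d(3)]
      tensor_mor_mor[OF fg d(3)] tensor_mor_mor[OF d(1) gh]
    by (rule relabel_natural[OF is_diagram_par[OF fg d(3)] is_diagram_par[OF d(1) gh]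
          port_iso_assoc[OF admissibleD(1)[OF f] admissibleD(1)[OF g] admissibleD(1)[OF h]]
          port_iso_assoc[OF admissibleD(2)[OF f] admissibleD(2)[OF g] admissibleD(2)[OF h]]])
      (simp_all add: wire_maps_par[OF fg d(3)] wire_maps_par[OF d(1) gh]
        wire_maps_par[OF d(1) d(2)] wire_maps_par[OF d(2) d(3)] pull_join join_assoc split_assoc_fun split_assoc_inv)
qed

lemma lunit_natural:
  assumes f: "admissible X X' f"
  shows "wcomp (Lunit dDWD X') (tensor_mor (Idt dDWD unit_obj) (mor X X' f))
    = wcomp (mor X X' f) (Lunit dDWD X)"
proof -
  note d = admissibleD(3)[OF f]
  have u: "is_diagram unit_obj unit_obj (relabel unit_obj id)"
    by (intro is_diagram_relabel is_diface_unit) auto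
  show ?thesis
    unfolding dDWD_structure tensor_mor_mor[OF u d]
    by (rule relabel_natural[OF is_diagram_par[OF u d] d port_iso_lunit[OF admissibleD(1)[OF f]]
          port_iso_lunit[OF admissibleD(2)[OF f]]])
      (simp_all add: wire_maps_par[OF u d] join_empty split_codiagonal)
qed

lemma runit_natural:
  assumes f: "admissible X X' f"
  shows "wcomp (Runit dDWD X') (tensor_mor (mor X X' f) (Idt dDWD unit_obj))
    = wcomp (mor X X' f) (Runit dDWD X)"
proof -
  note d = admissibleD(3)[OF f]
  have u: "is_diagram unit_obj unit_obj (relabel unit_obj id)"
    by (intro is_diagram_relabel is_diface_unit) auto
  show ?thesis
    unfolding dDWD_structure tensor_mor_mor[OF d u]
    by (rule relabel_natural[OF is_diagram_par[OF d u] d port_iso_runit[OF admissibleD(1)[OF f]]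
          port_iso_runit[OF admissibleD(2)[OF f]]])
      (simp_all add: wire_maps_par[OF d u] join_empty split_codiagonal)
qed

text \<open>
  On input and output wires this is associativity of composition of maps. For trace wires, both
  sides are the sum of the same three terms, once the input map of \<open>f\<close> is distributed over
  the sum of the trace contributions of \<open>g\<close> and \<open>h\<close>.
\<close>

lemma wcomp_assoc:
  assumes f: "admissible W X f" and g: "admissible X Y g" and h: "admissible Y Z h"
  shows "wcomp (mor Y Z h) (wcomp (mor X Y g) (mor W X f))
    = wcomp (wcomp (mor Y Z h) (mor X Y g)) (mor W X f)"
proof -
  note d = admissibleD(3)[OF f] admissibleD(3)[OF g] admissibleD(3)[OF h]
  note gf = is_diagram_comp[OF d(1) d(2)] and hg = is_diagram_comp[OF d(2) d(3)]
  have "(diagram_comp h (diagram_comp g f), diagram_comp (diagram_comp h g) f) \<in> diagram_eq"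
    by (rule diagram_eqI[OF is_diagram_comp[OF gf d(3)] is_diagram_comp[OF d(1) hg]])
      (simp_all add: wire_maps_comp[OF gf d(3)] wire_maps_comp[OF d(1) hg]
        wire_maps_comp[OF d(1) d(2)] wire_maps_comp[OF d(2) d(3)] in_map_vadd[OF d(1)] vadd_assoc)
  then show ?thesis
    by (simp add: wcomp_mor[OF d(1) d(2)] wcomp_mor[OF d(2) d(3)] wcomp_mor[OF gf d(3)]
        wcomp_mor[OF d(1) hg] mor_eq_iff)
qed

lemma wcomp_Idt:
  assumes f: "admissible X Y f"
  shows "wcomp (Idt dDWD Y) (mor X Y f) = mor X Y f" "wcomp (mor X Y f) (Idt dDWD X) = mor X Y f"
proof -
  note d = admissibleD(3)[OF f]
  have i: "is_diagram X X (relabel X id)" "is_diagram Y Y (relabel Y id)"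
    using admissibleD(1,2)[OF f] by (auto intro!: is_diagram_relabel)
  have push_id: "push A id A x = x" if "x \<in> RR A" for A :: "'a univ set" and x
    using that by (subst push_inverse[where k = id]) (auto intro: pull_id)
  have "(diagram_comp (relabel Y id) f, f) \<in> diagram_eq"
    by (rule diagram_eqI[OF is_diagram_comp[OF d i(2)] d])
      (simp_all add: wire_maps_comp[OF d i(2)] wire_maps_relabel pull_id push_id in_map_zero[OF d] vadd_zero)
  then show "wcomp (Idt dDWD Y) (mor X Y f) = mor X Y f"
    by (simp add: dDWD_structure wcomp_mor[OF d i(2)] mor_eq_iff)
  have "(diagram_comp f (relabel X id), f) \<in> diagram_eq"
    by (rule diagram_eqI[OF is_diagram_comp[OF i(1) d] d])
      (simp_all add: wire_maps_comp[OF i(1) d] wire_maps_relabel pull_id push_id vadd_zero)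
  then show "wcomp (mor X Y f) (Idt dDWD X) = mor X Y f"
    by (simp add: dDWD_structure wcomp_mor[OF i(1) d] mor_eq_iff)
qed

lemma tensor_mor_wcomp:
  assumes f: "admissible X X' f" and f': "admissible X' X'' f'"
    and g: "admissible Y Y' g" and g': "admissible Y' Y'' g'"
  shows "tensor_mor (wcomp (mor X' X'' f') (mor X X' f)) (wcomp (mor Y' Y'' g') (mor Y Y' g))
    = wcomp (tensor_mor (mor X' X'' f') (mor Y' Y'' g')) (tensor_mor (mor X X' f) (mor Y Y' g))"
proof -
  note d = admissibleD(3)[OF f] admissibleD(3)[OF f'] admissibleD(3)[OF g] admissibleD(3)[OF g']
  note c = is_diagram_comp[OF d(1) d(2)] is_diagram_comp[OF d(3) d(4)]
  note p = is_diagram_par[OF d(1) d(3)] is_diagram_par[OF d(2) d(4)]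
  have "(diagram_par (diagram_comp f' f) (diagram_comp g' g),
      diagram_comp (diagram_par f' g') (diagram_par f g)) \<in> diagram_eq"
    by (rule diagram_eqI[OF is_diagram_par[OF c] is_diagram_comp[OF p]])
      (simp_all add: wire_maps_par[OF c] wire_maps_comp[OF p] wire_maps_par[OF d(1) d(3)]
        wire_maps_par[OF d(2) d(4)] wire_maps_comp[OF d(1) d(2)] wire_maps_comp[OF d(3) d(4)]
        pull_join join_vadd)
  then show ?thesis
    by (simp add: wcomp_mor[OF d(1) d(2)] wcomp_mor[OF d(3) d(4)] tensor_mor_mor[OF c]
        tensor_mor_mor[OF d(1) d(3)] tensor_mor_mor[OF d(2) d(4)] wcomp_mor[OF p] mor_eq_iff)
qed

lemma port_iso_preserves_dep: "port_iso X Y h k \<Longrightarrow> preserves_dep X Y h"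
  unfolding port_iso_def by simp

lemma pentagon_dDWD:
  assumes "is_diface W" "is_diface X" "is_diface Y" "is_diface Z"
  shows "wcomp (Assoc dDWD W X (tensor_obj Y Z)) (Assoc dDWD (tensor_obj W X) Y Z)
    = wcomp (tensor_mor (Idt dDWD W) (Assoc dDWD X Y Z))
        (wcomp (Assoc dDWD W (tensor_obj X Y) Z) (tensor_mor (Assoc dDWD W X Y) (Idt dDWD Z)))"
proof -
  note a = port_iso_assoc[THEN port_iso_preserves_dep] and t = is_diface_tensor
  note m = a[OF assms(1,2) t[OF assms(3,4)]] a[OF t[OF assms(1,2)] assms(3,4)]
    preserves_dep_tensor[OF preserves_dep_id[OF assms(1)] a[OF assms(2,3,4)]]
    a[OF assms(1) t[OF assms(2,3)] assms(4)]
    preserves_dep_tensor[OF a[OF assms(1,2,3)] preserves_dep_id[OF assms(4)]]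
  show ?thesis
    unfolding dDWD_structure relabel_tensor[OF preserves_dep_id[OF assms(1)] a[OF assms(2,3,4)]]
      relabel_tensor[OF a[OF assms(1,2,3)] preserves_dep_id[OF assms(4)]]
      relabel_comp[OF m(2,1)] relabel_comp[OF m(5,4)] relabel_comp[OF preserves_dep_comp[OF m(5,4)] m(3)]
    by (rule relabel_cong) (auto elim!: dunionE)
qed

lemma triangle_dDWD:
  assumes "is_diface X" "is_diface Y"
  shows "wcomp (tensor_mor (Idt dDWD X) (Lunit dDWD Y)) (Assoc dDWD X unit_obj Y)
    = tensor_mor (Runit dDWD X) (Idt dDWD Y)"
proof -
  note l = port_iso_lunit[OF assms(2), THEN port_iso_preserves_dep] and r = port_iso_runit[OF assms(1), THEN port_iso_preserves_dep]
  note a = port_iso_assoc[OF assms(1) is_diface_unit assms(2), THEN port_iso_preserves_dep]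
  show ?thesis
    unfolding dDWD_structure relabel_tensor[OF preserves_dep_id[OF assms(1)] l]
      relabel_tensor[OF r preserves_dep_id[OF assms(2)]] relabel_comp[OF a preserves_dep_tensor[OF preserves_dep_id[OF assms(1)] l]]
    by (rule relabel_cong) (auto elim!: dunionE)
qed

theorem monoidal_category_dDWD: "monoidal_category (dDWD :: ('a univ diface, 'a wmor) moncat)"
proof
  fix f :: "'a wmor"
  assume "f \<in> Ar dDWD"
  then show "Dom dDWD f \<in> Ob dDWD" "Cod dDWD f \<in> Ob dDWD"
    by (auto simp: Ar_dDWD_iff mor_def dest: admissibleD)
next
  fix X :: "'a univ diface"
  assume "X \<in> Ob dDWD"
  then show "Idt dDWD X \<in> Hom dDWD X X"
    by (auto simp: dDWD_structure intro!: admissible_mor_Hom admissible_relabel preserves_dep_id)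
next
  fix f g :: "'a wmor" and X Y Z
  assume "f \<in> Hom dDWD X Y" "g \<in> Hom dDWD Y Z"
  then show "Comp dDWD g f \<in> Hom dDWD X Z"
    by (auto simp: Hom_dDWD_iff wcomp_mor[OF admissibleD(3) admissibleD(3)] intro: admissible_comp)
next
  fix f :: "'a wmor" and X Y
  assume "f \<in> Hom dDWD X Y"
  then show "Comp dDWD (Idt dDWD Y) f = f" "Comp dDWD f (Idt dDWD X) = f"
    by (auto simp: Hom_dDWD_iff wcomp_Idt)
next
  fix f g h :: "'a wmor" and W X Y Z
  assume "f \<in> Hom dDWD W X" "g \<in> Hom dDWD X Y" "h \<in> Hom dDWD Y Z"
  then show "Comp dDWD h (Comp dDWD g f) = Comp dDWD (Comp dDWD h g) f"
    by (auto simp: Hom_dDWD_iff intro: wcomp_assoc)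
next
  fix X Y :: "'a univ diface"
  assume "X \<in> Ob dDWD" "Y \<in> Ob dDWD"
  then show "TenO dDWD X Y \<in> Ob dDWD"
    by (simp add: is_diface_tensor)
next
  show "Unit dDWD \<in> Ob (dDWD :: ('a univ diface, 'a wmor) moncat)"
    by (simp add: is_diface_unit)
next
  fix f g :: "'a wmor" and X X' Y Y'
  assume "f \<in> Hom dDWD X X'" "g \<in> Hom dDWD Y Y'"
  then show "TenA dDWD f g \<in> Hom dDWD (TenO dDWD X Y) (TenO dDWD X' Y')"
    by (auto simp: Hom_dDWD_iff tensor_mor_mor[OF admissibleD(3) admissibleD(3)] intro: admissible_par)
next
  fix X Y :: "'a univ diface"
  assume "X \<in> Ob dDWD" "Y \<in> Ob dDWD"
  then have "tensor_mor (mor X X (relabel X id)) (mor Y Y (relabel Y id))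
      = mor (tensor_obj X Y) (tensor_obj X Y) (relabel (tensor_obj X Y) id)"
    by (subst relabel_tensor) (auto simp: preserves_dep_id elim!: dunionE intro!: relabel_cong)
  then show "TenA dDWD (Idt dDWD X) (Idt dDWD Y) = Idt dDWD (TenO dDWD X Y)"
    by (simp add: dDWD_structure)
next
  fix f f' g g' :: "'a wmor" and X X' X'' Y Y' Y''
  assume "f \<in> Hom dDWD X X'" "f' \<in> Hom dDWD X' X''" "g \<in> Hom dDWD Y Y'" "g' \<in> Hom dDWD Y' Y''"
  then show "TenA dDWD (Comp dDWD f' f) (Comp dDWD g' g) = Comp dDWD (TenA dDWD f' g') (TenA dDWD f g)"
    by (auto simp: Hom_dDWD_iff intro: tensor_mor_wcomp)
next
  fix X Y Z :: "'a univ diface"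
  assume "X \<in> Ob dDWD" "Y \<in> Ob dDWD" "Z \<in> Ob dDWD"
  then show "Assoc dDWD X Y Z
      \<in> iso_Hom dDWD (TenO dDWD (TenO dDWD X Y) Z) (TenO dDWD X (TenO dDWD Y Z))"
    by (auto simp: dDWD_structure intro: relabel_iso_Hom port_iso_assoc)
next
  fix X :: "'a univ diface"
  assume "X \<in> Ob dDWD"
  then show "Lunit dDWD X \<in> iso_Hom dDWD (TenO dDWD (Unit dDWD) X) X"
    "Runit dDWD X \<in> iso_Hom dDWD (TenO dDWD X (Unit dDWD)) X"
    by (auto simp: dDWD_structure intro: relabel_iso_Hom port_iso_lunit port_iso_runit)
next
  fix f g h :: "'a wmor" and X X' Y Y' Z Z'
  assume "f \<in> Hom dDWD X X'" "g \<in> Hom dDWD Y Y'" "h \<in> Hom dDWD Z Z'"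
  then show "Comp dDWD (Assoc dDWD X' Y' Z') (TenA dDWD (TenA dDWD f g) h)
      = Comp dDWD (TenA dDWD f (TenA dDWD g h)) (Assoc dDWD X Y Z)"
    by (auto simp: Hom_dDWD_iff intro: assoc_natural)
next
  fix f :: "'a wmor" and X X'
  assume "f \<in> Hom dDWD X X'"
  then show "Comp dDWD (Lunit dDWD X') (TenA dDWD (Idt dDWD (Unit dDWD)) f) = Comp dDWD f (Lunit dDWD X)"
    "Comp dDWD (Runit dDWD X') (TenA dDWD f (Idt dDWD (Unit dDWD))) = Comp dDWD f (Runit dDWD X)"
    by (auto simp: Hom_dDWD_iff intro: lunit_natural runit_natural)
next
  fix W X Y Z :: "'a univ diface"
  assume "W \<in> Ob dDWD" "X \<in> Ob dDWD" "Y \<in> Ob dDWD" "Z \<in> Ob dDWD"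
  then show "Comp dDWD (Assoc dDWD W X (TenO dDWD Y Z)) (Assoc dDWD (TenO dDWD W X) Y Z)
      = Comp dDWD (TenA dDWD (Idt dDWD W) (Assoc dDWD X Y Z))
          (Comp dDWD (Assoc dDWD W (TenO dDWD X Y) Z) (TenA dDWD (Assoc dDWD W X Y) (Idt dDWD Z)))"
    by (simp add: pentagon_dDWD)
next
  fix X Y :: "'a univ diface"
  assume "X \<in> Ob dDWD" "Y \<in> Ob dDWD"
  then show "Comp dDWD (TenA dDWD (Idt dDWD X) (Lunit dDWD Y)) (Assoc dDWD X (Unit dDWD) Y)
      = TenA dDWD (Runit dDWD X) (Idt dDWD Y)"
    by (simp add: triangle_dDWD)
qed

section \<open>Feedback\<close>

lemma machinesD:
  assumes "m \<in> machines X"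
  shows "finite (states m)"
    and "\<And>a x. a \<in> RR (inp X) \<Longrightarrow> x \<in> RR (states m) \<Longrightarrow> update m (a, x) \<in> RR (states m)"
    and "\<And>a x. a \<in> RR (inp X) \<Longrightarrow> x \<in> RR (states m) \<Longrightarrow> readout m (a, x) \<in> RR (outp X)"
  using assms unfolding machines_def by auto

lemma readout_dep:
  assumes "m \<in> machines X" "x \<in> RR (states m)" "p \<in> RR (inp X)" "q \<in> RR (inp X)" "j \<in> outp X"
    and "\<And>i. (i, j) \<in> dep X \<Longrightarrow> p i = q i"
  shows "readout m (p, x) j = readout m (q, x) j"
proof -
  have "respects_span (inp X) (outp X) (rel_span (dep X)) (\<lambda>a. readout m (a, x))"
    using assms(1,2) unfolding machines_def by blast
  moreover have "\<forall>i \<in> src (rel_span (dep X)) ` {w \<in> apex (rel_span (dep X)). tgt (rel_span (dep X)) w = j}.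
      p i = q i"
    using assms(6) by (auto simp: rel_span_def)
  ultimately show ?thesis
    using assms(3,4,5) unfolding respects_span_def by blast
qed

lemma machinesI:
  assumes "finite (states m)"
    and "\<And>a x. a \<in> RR (inp X) \<Longrightarrow> x \<in> RR (states m) \<Longrightarrow> update m (a, x) \<in> RR (states m)"
    and "\<And>a x. a \<in> RR (inp X) \<Longrightarrow> x \<in> RR (states m) \<Longrightarrow> readout m (a, x) \<in> RR (outp X)"
    and "\<And>p q x j. x \<in> RR (states m) \<Longrightarrow> p \<in> RR (inp X) \<Longrightarrow> q \<in> RR (inp X) \<Longrightarrow> j \<in> outp X \<Longrightarrow>
      (\<And>i. (i, j) \<in> dep X \<Longrightarrow> p i = q i) \<Longrightarrow> readout m (p, x) j = readout m (q, x) j"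
  shows "m \<in> machines X"
proof -
  have "respects_span (inp X) (outp X) (rel_span (dep X)) (\<lambda>a. readout m (a, x))"
    if "x \<in> RR (states m)" for x
    unfolding respects_span_def
  proof (intro ballI impI)
    fix j p q assume "j \<in> outp X" "p \<in> RR (inp X)" "q \<in> RR (inp X)"
      and agree: "\<forall>i \<in> src (rel_span (dep X)) ` {w \<in> apex (rel_span (dep X)). tgt (rel_span (dep X)) w = j}.
        p i = q i"
    have "p i = q i" if "(i, j) \<in> dep X" for i
      using agree that by (force simp: rel_span_def)
    with \<open>j \<in> outp X\<close> \<open>p \<in> RR (inp X)\<close> \<open>q \<in> RR (inp X)\<close> show "readout m (p, x) j = readout m (q, x) j"
      by (intro assms(4)[OF that])
  qed
  then show ?thesis
    using assms(1-3) unfolding machines_def by auto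
qed

text \<open>The fixed points that \<^const>\<open>fixpt\<close> describes, with the two coordinates separated.\<close>

definition feedback_sol :: "'a univ diface \<Rightarrow> 'a diagram \<Rightarrow> ('a vec \<times> 'a vec \<Rightarrow> 'a vec)
    \<Rightarrow> 'a vec \<Rightarrow> 'a vec \<Rightarrow> 'a vec \<times> 'a vec \<Rightarrow> bool" where
  "feedback_sol X f r a x p \<longleftrightarrow> fst p \<in> RR (inp X) \<and> snd p \<in> RR (outp X) \<and>
     fst p = vadd (inp X) (tr_map X f (snd p)) a \<and> snd p = r (fst p, x)"

lemma feedback_solI:
  assumes "fst p \<in> RR (inp X)" "snd p \<in> RR (outp X)"
    "fst p = vadd (inp X) (tr_map X f (snd p)) a" "snd p = r (fst p, x)"
  shows "feedback_sol X f r a x p"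
  using assms unfolding feedback_sol_def by blast

lemma feedback_solD:
  assumes "feedback_sol X f r a x p"
  shows "fst p \<in> RR (inp X)" "snd p \<in> RR (outp X)"
    and "fst p = vadd (inp X) (tr_map X f (snd p)) a" and "snd p = r (fst p, x)"
  using assms unfolding feedback_sol_def by blast+

lemma wf_dep_edges: "admissible X Y f \<Longrightarrow> wf (dep_edges X f)"
  unfolding admissible_iff by (auto intro: finite_acyclic_wf finite_dep_edges)

text \<open>
  By induction along the acyclic dependency graph: the value at a port is computed from the
  values at its predecessors and, at an input port, from the offset. Hence it depends only on the
  offsets at the input ports from which the port can be reached.
\<close>

lemma feedback_sol_agree:
  assumes f: "admissible X Y f" and m: "m \<in> machines X" and x: "x \<in> RR (states m)"
    and p: "feedback_sol X f (readout m) a x p" and q: "feedback_sol X f (readout m) b x q"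
    and "\<And>i. i \<in> inp X \<Longrightarrow> (Inl i, v) \<in> (dep_edges X f)\<^sup>* \<Longrightarrow> a i = b i"
  shows "case_sum (fst p) (snd p) v = case_sum (fst q) (snd q) v"
  using wf_dep_edges[OF f] assms(6)
proof (induction v rule: wf_induct_rule)
  case (less v)
  have pred: "case_sum (fst p) (snd p) u = case_sum (fst q) (snd q) u" if "(u, v) \<in> dep_edges X f" for u
    using that less.prems by (intro less.IH) (auto intro: rtrancl_into_rtrancl)
  have pred_in: "fst p i = fst q i" if "(Inl i, v) \<in> dep_edges X f" for i
    using pred[OF that] by simp
  have pred_out: "snd p j = snd q j" if "(Inr j, v) \<in> dep_edges X f" for j
    using pred[OF that] by simp
  show ?case
  proof (cases v)
    case (Inl i)
    show ?thesis
    proof (cases "i \<in> inp X")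
      case True
      have "tr_map X f (snd p) i = tr_map X f (snd q) i"
        unfolding tr_map_def span_map_apply[OF True]
        using pred_out Inl by (intro sum.cong) (auto dest!: dep_edgesI(1)[where X = X])
      then have "vadd (inp X) (tr_map X f (snd p)) a i = vadd (inp X) (tr_map X f (snd q)) b i"
        using True less.prems[of i] Inl by (simp add: vadd_apply)
      then have "fst p i = fst q i"
        using feedback_solD(3)[OF p] feedback_solD(3)[OF q] by metis
      then show ?thesis
        using Inl by simp
    next
      case False
      then show ?thesis
        using Inl RR_outside[OF feedback_solD(1)[OF p]] RR_outside[OF feedback_solD(1)[OF q]] by simp
    qed
  next
    case (Inr j)
    show ?thesis
    proof (cases "j \<in> outp X")
      case True
      have "readout m (fst p, x) j = readout m (fst q, x) j"
        using pred_in Inr True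
        by (intro readout_dep[OF m x] feedback_solD(1)[OF p] feedback_solD(1)[OF q])
          (auto dest!: dep_edgesI(2)[where f = f])
      then have "snd p j = snd q j"
        using feedback_solD(4)[OF p] feedback_solD(4)[OF q] by metis
      then show ?thesis
        using Inr by simp
    next
      case False
      then show ?thesis
        using Inr RR_outside[OF feedback_solD(2)[OF p]] RR_outside[OF feedback_solD(2)[OF q]] by simp
    qed
  qed
qed

text \<open>
  The right-hand side of the fixed point equation at a port uses only the values at its
  predecessors in the dependency graph. As this finite graph is acyclic, a solution is obtained
  by well-founded recursion along it.
\<close>

lemma feedback_sol_exists:
  assumes f: "admissible X Y f" and m: "m \<in> machines X" and x: "x \<in> RR (states m)"
  shows "\<exists>p. feedback_sol X f (readout m) a x p"
proof -
  \<comment> \<open>The recursion runs over vectors on all ports at once, on the sum type of the graph vertices.\<close>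
  define F where "F q = case_sum (vadd (inp X) (tr_map X f (\<lambda>j\<in>outp X. q (Inr j))) a)
    (readout m (\<lambda>i\<in>inp X. q (Inl i), x))" for q :: "'a univ + 'a univ \<Rightarrow> real"
  have "adm_wf (dep_edges X f) F"
    unfolding adm_wf_def
  proof (intro allI impI)
    fix q q' :: "'a univ + 'a univ \<Rightarrow> real" and v
    assume pred: "\<forall>u. (u, v) \<in> dep_edges X f \<longrightarrow> q u = q' u"
    show "F q v = F q' v"
    proof (cases v)
      case (Inl i)
      have "tr_map X f (\<lambda>j\<in>outp X. q (Inr j)) i = tr_map X f (\<lambda>j\<in>outp X. q' (Inr j)) i" if "i \<in> inp X"
        unfolding tr_map_def span_map_apply[OF that]
        using pred Inl by (intro sum.cong) (auto dest!: dep_edgesI(1)[where X = X])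
      then show ?thesis
        using Inl by (simp add: F_def vadd_def)
    next
      case (Inr j)
      show ?thesis
      proof (cases "j \<in> outp X")
        case True
        have "is_diface X"
          using f by (rule admissibleD)
        then show ?thesis
          using pred Inr True unfolding F_def
          by (auto simp: is_diface_def intro!: readout_dep[OF m x] dest!: dep_edgesI(2)[where f = f])
      next
        case False
        then show ?thesis
          using Inr machinesD(3)[OF m] x by (simp add: F_def RR_outside[OF _ False])
      qed
    qed
  qed
  then have fp: "wfrec (dep_edges X f) F = F (wfrec (dep_edges X f) F)"
    by (rule wfrec_fixpoint[OF wf_dep_edges[OF f]])
  define q where "q = wfrec (dep_edges X f) F"
  have q: "q v = F q v" for v
    unfolding q_def by (rule fun_cong[OF fp])
  have "feedback_sol X f (readout m) a x (\<lambda>i\<in>inp X. q (Inl i), \<lambda>j\<in>outp X. q (Inr j))"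
  proof (rule feedback_solI; unfold fst_conv snd_conv)
    show "(\<lambda>i\<in>inp X. q (Inl i)) = vadd (inp X) (tr_map X f (\<lambda>j\<in>outp X. q (Inr j))) a"
    proof (rule RR_eqI[where A = "inp X"])
      fix i assume "i \<in> inp X"
      then show "(\<lambda>i\<in>inp X. q (Inl i)) i = vadd (inp X) (tr_map X f (\<lambda>j\<in>outp X. q (Inr j))) a i"
        using q[of "Inl i"] unfolding F_def by simp
    qed auto
    show "(\<lambda>j\<in>outp X. q (Inr j)) = readout m (\<lambda>i\<in>inp X. q (Inl i), x)"
    proof (rule RR_eqI[where A = "outp X"])
      fix j assume "j \<in> outp X"
      then show "(\<lambda>j\<in>outp X. q (Inr j)) j = readout m (\<lambda>i\<in>inp X. q (Inl i), x) j"
        using q[of "Inr j"] unfolding F_def by simp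
    qed (use machinesD(3)[OF m _ x] in auto)
  qed auto
  then show ?thesis ..
qed

text \<open>
  Uniqueness is the comparison of two solutions for the same offset. In the sequel a fixed
  point is identified by exhibiting a solution and applying this lemma.
\<close>

lemma fixpt_eq:
  assumes f: "admissible X Y f" and m: "m \<in> machines X" and x: "x \<in> RR (states m)"
    and p: "feedback_sol X f (readout m) a x p"
  shows "fixpt X f (readout m) a x = p"
proof -
  have sol_iff: "q \<in> RR (inp X) \<times> RR (outp X) \<and>
      q = (vadd (inp X) (span_map (inp X) (Wtr f) (snd q)) a, readout m (fst q, x))
      \<longleftrightarrow> feedback_sol X f (readout m) a x q" for q
    unfolding feedback_sol_def tr_map_def prod_eq_iff mem_Times_iff fst_conv snd_conv by blast
  show ?thesis
    unfolding fixpt_def sol_iff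
  proof (rule the_equality)
    fix q assume q: "feedback_sol X f (readout m) a x q"
    have "case_sum (fst q) (snd q) v = case_sum (fst p) (snd p) v" for v
      using q p by (rule feedback_sol_agree[OF f m x]) simp
    from this[of "Inl _"] this[of "Inr _"] show "q = p"
      by (simp add: prod_eq_iff fun_eq_iff)
  qed (fact p)
qed

lemma feedback_sol_fixpt:
  assumes "admissible X Y f" "m \<in> machines X" "x \<in> RR (states m)"
  shows "feedback_sol X f (readout m) a x (fixpt X f (readout m) a x)"
  using feedback_sol_exists[OF assms] fixpt_eq[OF assms] by metis

section \<open>The action of diagrams on machines\<close>

lemma act_sel [simp]:
  "states (act X Y f m) = states m"
  "update (act X Y f m) (y, x) = update m (fst (fixpt X f (readout m) (in_map X f y) x), x)"
  "readout (act X Y f m) (y, x) = out_map Y f (snd (fixpt X f (readout m) (in_map X f y) x))"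
  by (simp_all add: act_def in_map_def out_map_def)

text \<open>
  The new readout respects the dependency of the codomain: an output \<open>j\<close> depends on the values at
  the sources of the output wires to \<open>j\<close>, hence on the offsets at the input ports from which such a
  source can be reached, hence on the outer inputs that are related to \<open>j\<close> by the image of the
  dependency of the domain, and this image is contained in the dependency of the codomain.
\<close>

lemma act_machines:
  assumes f: "admissible X Y f" and m: "m \<in> machines X"
  shows "act X Y f m \<in> machines Y"
proof (rule machinesI)
  note sol = feedback_sol_fixpt[OF f m]
  show "finite (states (act X Y f m))"
    using machinesD(1)[OF m] by simp
  fix x assume "x \<in> RR (states (act X Y f m))"
  then have x: "x \<in> RR (states m)"
    by simp
  show "update (act X Y f m) (a, x) \<in> RR (states (act X Y f m))" for a
    using feedback_solD(1)[OF sol[OF x]] machinesD(2)[OF m _ x] by simp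
  show "readout (act X Y f m) (a, x) \<in> RR (outp Y)" for a
    by simp
  fix y y' :: "'a vec" and j
  assume j: "j \<in> outp Y" and agree: "\<And>i. (i, j) \<in> dep Y \<Longrightarrow> y i = y' i"
  have "snd (fixpt X f (readout m) (in_map X f y) x) (src (Wout f) w)
      = snd (fixpt X f (readout m) (in_map X f y') x) (src (Wout f) w)"
    if w: "w \<in> apex (Wout f)" "tgt (Wout f) w = j" for w
  proof -
    have offsets: "in_map X f y i = in_map X f y' i"
      if i: "i \<in> inp X" "(Inl i, Inr (src (Wout f) w)) \<in> (dep_edges X f)\<^sup>*" for i
    proof -
      have "(src (Win f) v, j) \<in> dep Y" if "v \<in> apex (Win f)" "tgt (Win f) v = i" for v
        using f w i that unfolding admissible_iff by (auto simp: rtrancl_eq_or_trancl)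
      then show ?thesis
        using i agree by (auto simp: in_map_def span_map_apply intro!: sum.cong)
    qed
    let ?p = "\<lambda>y. fixpt X f (readout m) (in_map X f y) x" and ?v = "Inr (src (Wout f) w)"
    have "case_sum (fst (?p y)) (snd (?p y)) ?v = case_sum (fst (?p y')) (snd (?p y')) ?v"
      using offsets by (rule feedback_sol_agree[OF f m x sol[OF x] sol[OF x]])
    then show ?thesis
      by simp
  qed
  then show "readout (act X Y f m) (y, x) j = readout (act X Y f m) (y', x) j"
    using j by (auto simp: out_map_def span_map_apply intro!: sum.cong)
qed

lemma machine_eqI:
  assumes "m \<in> machines X" "m' \<in> machines X" "bij_betw h (states m) (states m')"
    and "\<And>a x. a \<in> RR (inp X) \<Longrightarrow> x \<in> RR (states m') \<Longrightarrow>
      update m (a, pull (states m) h x) = pull (states m) h (update m' (a, x))"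
    and "\<And>a x. a \<in> RR (inp X) \<Longrightarrow> x \<in> RR (states m') \<Longrightarrow>
      readout m (a, pull (states m) h x) = readout m' (a, x)"
  shows "(m, m') \<in> machine_eq X"
  using assms unfolding machine_eq_def by blast

lemma machine_eqE:
  assumes "(m, m') \<in> machine_eq X"
  obtains h where "m \<in> machines X" "m' \<in> machines X" "bij_betw h (states m) (states m')"
    and "\<And>a x. a \<in> RR (inp X) \<Longrightarrow> x \<in> RR (states m') \<Longrightarrow>
      update m (a, pull (states m) h x) = pull (states m) h (update m' (a, x))"
    and "\<And>a x. a \<in> RR (inp X) \<Longrightarrow> x \<in> RR (states m') \<Longrightarrow>
      readout m (a, pull (states m) h x) = readout m' (a, x)"
  using assms unfolding machine_eq_def by blast

lemma machine_eq_of_same_states: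
  assumes "m \<in> machines X" "m' \<in> machines X" "states m = states m'"
    and "\<And>a x. a \<in> RR (inp X) \<Longrightarrow> x \<in> RR (states m') \<Longrightarrow> update m (a, x) = update m' (a, x)"
    and "\<And>a x. a \<in> RR (inp X) \<Longrightarrow> x \<in> RR (states m') \<Longrightarrow> readout m (a, x) = readout m' (a, x)"
  shows "(m, m') \<in> machine_eq X"
  using assms machinesD(2)[OF assms(2)]
  by (intro machine_eqI[where h = id]) (auto simp: pull_id)

lemma machine_eq_sym:
  assumes "(m, m') \<in> machine_eq X"
  shows "(m', m) \<in> machine_eq X"
proof -
  from assms obtain h where m: "m \<in> machines X" "m' \<in> machines X"
    and h: "bij_betw h (states m) (states m')"
    and u: "\<And>a x. a \<in> RR (inp X) \<Longrightarrow> x \<in> RR (states m') \<Longrightarrow>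
      update m (a, pull (states m) h x) = pull (states m) h (update m' (a, x))"
    and r: "\<And>a x. a \<in> RR (inp X) \<Longrightarrow> x \<in> RR (states m') \<Longrightarrow>
      readout m (a, pull (states m) h x) = readout m' (a, x)"
    by (elim machine_eqE) blast
  define k where "k = inv_into (states m) h"
  have k: "bij_betw k (states m') (states m)"
    unfolding k_def using h by (rule bij_betw_inv_into)
  have hk: "h (k b) = b" if "b \<in> states m'" for b
    unfolding k_def using h that by (rule bij_betw_inv_into_right)
  have kh: "k (h b) = b" if "b \<in> states m" for b
    unfolding k_def using h that by (rule bij_betw_inv_into_left)
  have pull_hk: "pull (states m) h (pull (states m') k x) = x" if "x \<in> RR (states m)" for x
    using that kh bij_betw_apply[OF h] by (intro RR_eqI[of _ "states m"]) (auto simp: pull_apply)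
  have pull_kh: "pull (states m') k (pull (states m) h x) = x" if "x \<in> RR (states m')" for x
    using that hk bij_betw_apply[OF k] by (intro RR_eqI[of _ "states m'"]) (auto simp: pull_apply)
  show ?thesis
  proof (rule machine_eqI[OF m(2,1) k])
    fix a x assume a: "a \<in> RR (inp X)" and x: "x \<in> RR (states m)"
    show "update m' (a, pull (states m') k x) = pull (states m') k (update m (a, x))"
      using u[OF a, of "pull (states m') k x"] pull_hk[OF x] machinesD(2)[OF m(2) a]
      by (simp add: pull_kh)
    show "readout m' (a, pull (states m') k x) = readout m (a, x)"
      using r[OF a, of "pull (states m') k x"] pull_hk[OF x] by simp
  qed
qed

lemma machine_eq_trans:
  assumes "(m, m') \<in> machine_eq X" "(m', m'') \<in> machine_eq X"
  shows "(m, m'') \<in> machine_eq X"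
proof -
  from assms(1) obtain h where m: "m \<in> machines X" "m' \<in> machines X"
    and h: "bij_betw h (states m) (states m')"
    and u: "\<And>a x. a \<in> RR (inp X) \<Longrightarrow> x \<in> RR (states m') \<Longrightarrow>
      update m (a, pull (states m) h x) = pull (states m) h (update m' (a, x))"
    and r: "\<And>a x. a \<in> RR (inp X) \<Longrightarrow> x \<in> RR (states m') \<Longrightarrow>
      readout m (a, pull (states m) h x) = readout m' (a, x)"
    by (elim machine_eqE) blast
  from assms(2) obtain k where m': "m'' \<in> machines X"
    and k: "bij_betw k (states m') (states m'')"
    and u': "\<And>a x. a \<in> RR (inp X) \<Longrightarrow> x \<in> RR (states m'') \<Longrightarrow>
      update m' (a, pull (states m') k x) = pull (states m') k (update m'' (a, x))"
    and r': "\<And>a x. a \<in> RR (inp X) \<Longrightarrow> x \<in> RR (states m'') \<Longrightarrow>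
      readout m' (a, pull (states m') k x) = readout m'' (a, x)"
    by (elim machine_eqE) blast
  have comp: "pull (states m) (k \<circ> h) x = pull (states m) h (pull (states m') k x)" for x
    using bij_betw_apply[OF h] by (subst pull_pull) auto
  show ?thesis
    by (rule machine_eqI[OF m(1) m' bij_betw_trans[OF h k]]) (simp_all add: comp u r u' r')
qed

lemma machine_eq_equiv: "equiv (machines X) (machine_eq X)"
proof (rule equivI)
  show "refl_on (machines X) (machine_eq X)"
    by (auto simp: refl_on_def intro: machine_eq_of_same_states elim: machine_eqE)
  show "sym (machine_eq X)"
    by (auto simp: sym_def intro: machine_eq_sym)
  show "trans (machine_eq X)"
    by (auto simp: trans_def intro: machine_eq_trans)
qed (auto simp: machine_eq_def)

lemma machine_class_eq: "(m, m') \<in> machine_eq X \<Longrightarrow> machine_class X m = machine_class X m'"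
  unfolding machine_class_def by (rule equiv_class_eq[OF machine_eq_equiv])

lemma machine_class_Mealy: "m \<in> machines X \<Longrightarrow> machine_class X m \<in> Mealy X"
  unfolding Mealy_def machine_class_def by (rule quotientI)

lemma MealyE:
  assumes "M \<in> Mealy X"
  obtains m where "m \<in> machines X" "M = machine_class X m"
  using assms unfolding Mealy_def machine_class_def by (auto elim: quotientE)

lemma mem_machine_class: "m' \<in> machine_class X m \<longleftrightarrow> (m, m') \<in> machine_eq X"
  unfolding machine_class_def by simp

lemma self_mem_machine_class: "m \<in> machines X \<Longrightarrow> m \<in> machine_class X m"
  unfolding mem_machine_class by (rule machine_eq_of_same_states) auto

text \<open>
  A bijection of state sets that respects the readouts leaves the fixed points unchanged, because
  these see the state only through the readout. So the same bijection works after the action.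
\<close>

lemma act_cong:
  assumes f: "admissible X Y f" and eq: "(m, m') \<in> machine_eq X"
  shows "(act X Y f m, act X Y f m') \<in> machine_eq Y"
proof -
  from eq obtain h where m: "m \<in> machines X" "m' \<in> machines X"
    and h: "bij_betw h (states m) (states m')"
    and u: "\<And>a x. a \<in> RR (inp X) \<Longrightarrow> x \<in> RR (states m') \<Longrightarrow>
      update m (a, pull (states m) h x) = pull (states m) h (update m' (a, x))"
    and r: "\<And>a x. a \<in> RR (inp X) \<Longrightarrow> x \<in> RR (states m') \<Longrightarrow>
      readout m (a, pull (states m) h x) = readout m' (a, x)"
    by (elim machine_eqE) blast
  note sol = feedback_sol_fixpt[OF f m(2)]
  have fp: "fixpt X f (readout m) a (pull (states m) h x) = fixpt X f (readout m') a x"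
    if "x \<in> RR (states m')" for a x
  proof -
    note p = sol[OF that, of a]
    have "feedback_sol X f (readout m) a (pull (states m) h x) (fixpt X f (readout m') a x)"
      using feedback_solD(1-3)[OF p] trans[OF feedback_solD(4)[OF p] sym[OF r[OF feedback_solD(1)[OF p] that]]]
      by (rule feedback_solI)
    then show ?thesis
      by (rule fixpt_eq[OF f m(1) pull_RR])
  qed
  have fst: "fst (fixpt X f (readout m') a x) \<in> RR (inp X)" if "x \<in> RR (states m')" for a x
    using feedback_solD(1)[OF sol[OF that]] .
  show ?thesis
    using h by (intro machine_eqI[of _ _ _ h] act_machines[OF f] m) (simp_all add: fp u fst)
qed

lemma Mealy_map_mor:
  assumes f: "admissible X Y f" and m: "m \<in> machines X"
  shows "Mealy_map (mor X Y f) (machine_class X m) = machine_class Y (act X Y f m)"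
proof -
  have "machine_class Y (act X Y f' m') = machine_class Y (act X Y f m)"
    if "(f, f') \<in> diagram_eq" "(m, m') \<in> machine_eq X" for f' m'
  proof -
    have "act X Y f' m' = act X Y f m'"
      using diagram_eq_imp_maps[OF that(1)]
      by (simp add: act_def fixpt_def in_map_def tr_map_def out_map_def)
    then show ?thesis
      using machine_class_eq[OF act_cong[OF f that(2)]] by simp
  qed
  then have "(\<Union>f'\<in>diagram_class f. \<Union>m'\<in>machine_class X m. machine_class Y (act X Y f' m'))
      = machine_class Y (act X Y f m)"
    using diagram_eq_refl self_mem_machine_class[OF m]
    by (fastforce simp: mem_diagram_class mem_machine_class)
  then show ?thesis
    by (simp add: Mealy_map_def mor_def)
qed

text \<open>
  Let \<open>q\<close> be the fixed point for the outer diagram and \<open>p\<close> the one for the inner diagram at the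
  offset given by \<open>q\<close>. Substituting the outer equations into the inner ones shows that \<open>p\<close> solves
  the equations of the composite, so by uniqueness it is the fixed point there.
\<close>

lemma act_comp:
  assumes f: "admissible X Y f" and g: "admissible Y Z g" and m: "m \<in> machines X"
  shows "(act X Z (diagram_comp g f) m, act Y Z g (act X Y f m)) \<in> machine_eq Z"
proof (rule machine_eq_of_same_states)
  note d = admissibleD(3)[OF f] admissibleD(3)[OF g]
  note gf = admissible_comp[OF f g]
  note n = act_machines[OF f m]
  show "act X Z (diagram_comp g f) m \<in> machines Z" "act Y Z g (act X Y f m) \<in> machines Z"
    by (intro act_machines f g gf m)+
  show "states (act X Z (diagram_comp g f) m) = states (act Y Z g (act X Y f m))"
    by simp
  fix z x assume "x \<in> RR (states (act Y Z g (act X Y f m)))"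
  then have x: "x \<in> RR (states m)" and x': "x \<in> RR (states (act X Y f m))"
    by simp_all
  define q where "q = fixpt Y g (readout (act X Y f m)) (in_map Y g z) x"
  define p where "p = fixpt X f (readout m) (in_map X f (fst q)) x"
  have q: "feedback_sol Y g (readout (act X Y f m)) (in_map Y g z) x q"
    unfolding q_def by (rule feedback_sol_fixpt[OF g n x'])
  have p: "feedback_sol X f (readout m) (in_map X f (fst q)) x p"
    unfolding p_def by (rule feedback_sol_fixpt[OF f m x])
  have snd_q: "snd q = out_map Y f (snd p)"
    using feedback_solD(4)[OF q] by (simp add: p_def)
  have fst_q: "fst q = vadd (inp Y) (tr_map Y g (out_map Y f (snd p))) (in_map Y g z)"
    using feedback_solD(3)[OF q] unfolding snd_q .
  have "fst p = vadd (inp X) (tr_map X (diagram_comp g f) (snd p)) (in_map X (diagram_comp g f) z)"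
    using feedback_solD(3)[OF p] unfolding wire_maps_comp[OF d] fst_q in_map_vadd[OF d(1)]
      vadd_assoc[symmetric] .
  then have "feedback_sol X (diagram_comp g f) (readout m) (in_map X (diagram_comp g f) z) x p"
    using feedback_solD[OF p] by (intro feedback_solI)
  then have "fixpt X (diagram_comp g f) (readout m) (in_map X (diagram_comp g f) z) x = p"
    by (rule fixpt_eq[OF gf m x])
  then show "update (act X Z (diagram_comp g f) m) (z, x) = update (act Y Z g (act X Y f m)) (z, x)"
    and "readout (act X Z (diagram_comp g f) m) (z, x) = readout (act Y Z g (act X Y f m)) (z, x)"
    using snd_q by (simp_all add: wire_maps_comp[OF d] flip: q_def p_def)
qed

text \<open>Without trace wires there is no feedback, and the fixed point is the offset with its readout.\<close>

lemma act_relabel: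
  assumes h: "port_iso X Y h k" and m: "m \<in> machines X" and x: "x \<in> RR (states m)"
  shows "update (act X Y (relabel X h) m) (y, x) = update m (pull (inp X) h y, x)"
    and "readout (act X Y (relabel X h) m) (y, x) = pull (outp Y) k (readout m (pull (inp X) h y, x))"
proof -
  have "feedback_sol X (relabel X h) (readout m) a x (a, readout m (a, x))" if "a \<in> RR (inp X)" for a
    using that machinesD(3)[OF m that x] by (simp add: feedback_sol_def wire_maps_relabel vadd_zero)
  then have "fixpt X (relabel X h) (readout m) a x = (a, readout m (a, x))" if "a \<in> RR (inp X)" for a
    using that by (intro fixpt_eq[OF admissible_relabel[OF port_iso_preserves_dep[OF h]] m x]) auto
  then show "update (act X Y (relabel X h) m) (y, x) = update m (pull (inp X) h y, x)"
    and "readout (act X Y (relabel X h) m) (y, x) = pull (outp Y) k (readout m (pull (inp X) h y, x))"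
    by (simp_all add: wire_maps_relabel push_port_iso[OF h])
qed

section \<open>Juxtaposition\<close>

lemma juxtapose_sel [simp]:
  "states (juxtapose X Y m n) = dunion (states m) (states n)"
  "update (juxtapose X Y m n) (c, z) = join_vec (states m) (states n)
    (update m (pull (inp X) InL c, pull (states m) InL z), update n (pull (inp Y) InR c, pull (states n) InR z))"
  "readout (juxtapose X Y m n) (c, z) = join_vec (outp X) (outp Y)
    (readout m (pull (inp X) InL c, pull (states m) InL z), readout n (pull (inp Y) InR c, pull (states n) InR z))"
  by (simp_all add: juxtapose_def split_vec_def)

lemma juxtapose_machines:
  assumes m: "m \<in> machines X" and n: "n \<in> machines Y"
  shows "juxtapose X Y m n \<in> machines (tensor_obj X Y)"
proof (rule machinesI)
  show "finite (states (juxtapose X Y m n))"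
    using machinesD(1)[OF m] machinesD(1)[OF n] by simp
  fix p q z j
  assume p: "p \<in> RR (inp (tensor_obj X Y))" and q: "q \<in> RR (inp (tensor_obj X Y))"
    and j: "j \<in> outp (tensor_obj X Y)"
    and agree: "\<And>i. (i, j) \<in> dep (tensor_obj X Y) \<Longrightarrow> p i = q i"
  show "readout (juxtapose X Y m n) (p, z) j = readout (juxtapose X Y m n) (q, z) j"
    using j unfolding tensor_obj_sel
  proof (cases rule: dunionE)
    case (1 k)
    have "readout m (pull (inp X) InL p, pull (states m) InL z) k
        = readout m (pull (inp X) InL q, pull (states m) InL z) k"
    proof (rule readout_dep[OF m])
      fix i assume i: "(i, k) \<in> dep X"
      then show "pull (inp X) InL p i = pull (inp X) InL q i"
        using agree[of "InL i"] 1 by (simp add: pull_def restrict_def)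
    qed (use 1 in simp_all)
    with 1 show ?thesis
      by (simp add: join_vec_apply)
  next
    case (2 k)
    have "readout n (pull (inp Y) InR p, pull (states n) InR z) k
        = readout n (pull (inp Y) InR q, pull (states n) InR z) k"
    proof (rule readout_dep[OF n])
      fix i assume i: "(i, k) \<in> dep Y"
      then show "pull (inp Y) InR p i = pull (inp Y) InR q i"
        using agree[of "InR i"] 2 by (simp add: pull_def restrict_def)
    qed (use 2 in simp_all)
    with 2 show ?thesis
      by (simp add: join_vec_apply)
  qed
qed simp_all

lemma bij_betw_dunion:
  assumes "bij_betw h A A'" "bij_betw k B B'"
  shows "bij_betw (copair (InL \<circ> h) (InR \<circ> k)) (dunion A B) (dunion A' B')"
  using assms unfolding bij_betw_def inj_on_def dunion_def
  by (simp add: ball_Un image_Un image_image) (simp flip: image_image)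

lemma juxtapose_cong:
  assumes "(m, m') \<in> machine_eq X" "(n, n') \<in> machine_eq Y"
  shows "(juxtapose X Y m n, juxtapose X Y m' n') \<in> machine_eq (tensor_obj X Y)"
proof -
  from assms(1) obtain h where m: "m \<in> machines X" "m' \<in> machines X"
    and h: "bij_betw h (states m) (states m')"
    and um: "\<And>a x. a \<in> RR (inp X) \<Longrightarrow> x \<in> RR (states m') \<Longrightarrow>
      update m (a, pull (states m) h x) = pull (states m) h (update m' (a, x))"
    and rm: "\<And>a x. a \<in> RR (inp X) \<Longrightarrow> x \<in> RR (states m') \<Longrightarrow>
      readout m (a, pull (states m) h x) = readout m' (a, x)"
    by (elim machine_eqE) blast
  from assms(2) obtain k where n: "n \<in> machines Y" "n' \<in> machines Y"
    and k: "bij_betw k (states n) (states n')"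
    and un: "\<And>a x. a \<in> RR (inp Y) \<Longrightarrow> x \<in> RR (states n') \<Longrightarrow>
      update n (a, pull (states n) k x) = pull (states n) k (update n' (a, x))"
    and rn: "\<And>a x. a \<in> RR (inp Y) \<Longrightarrow> x \<in> RR (states n') \<Longrightarrow>
      readout n (a, pull (states n) k x) = readout n' (a, x)"
    by (elim machine_eqE) blast
  let ?hk = "copair (InL \<circ> h) (InR \<circ> k)"
  have split: "pull (states m) InL (pull (dunion (states m) (states n)) ?hk z)
        = pull (states m) h (pull (states m') InL z)"
      "pull (states n) InR (pull (dunion (states m) (states n)) ?hk z)
        = pull (states n) k (pull (states n') InR z)" for z
    using bij_betw_apply[OF h] bij_betw_apply[OF k] by (auto intro!: pull_cong simp: pull_apply)
  have join: "join_vec (states m) (states n) (pull (states m) h x, pull (states n) k y)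
      = pull (dunion (states m) (states n)) ?hk (join_vec (states m') (states n') (x, y))" for x y
    using bij_betw_apply[OF h] bij_betw_apply[OF k]
    by (intro RR_dunion_eqI[of _ "states m" "states n"]) (auto simp: join_vec_apply pull_apply)
  show ?thesis
    by (rule machine_eqI[OF juxtapose_machines[OF m(1) n(1)] juxtapose_machines[OF m(2) n(2)],
          of "copair (InL \<circ> h) (InR \<circ> k)"])
      (use bij_betw_dunion[OF h k] in \<open>simp_all add: split join um un rm rn\<close>)
qed

lemma Mealy_laxator_class:
  assumes m: "m \<in> machines X" and n: "n \<in> machines Y"
  shows "Mealy_laxator X Y (machine_class X m, machine_class Y n)
    = machine_class (tensor_obj X Y) (juxtapose X Y m n)"
proof -
  let ?C = "machine_class (tensor_obj X Y) (juxtapose X Y m n)"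
  have "machine_class (tensor_obj X Y) (juxtapose X Y m' n') = ?C"
    if "m' \<in> machine_class X m" "n' \<in> machine_class Y n" for m' n'
    using machine_class_eq[OF juxtapose_cong] that unfolding mem_machine_class by metis
  then have "Mealy_laxator X Y (machine_class X m, machine_class Y n)
      = (\<Union>m'\<in>machine_class X m. \<Union>n'\<in>machine_class Y n. ?C)"
    unfolding Mealy_laxator_def by (simp cong: SUP_cong)
  also have "\<dots> = ?C"
    using self_mem_machine_class[OF m] self_mem_machine_class[OF n] by auto
  finally show ?thesis .
qed

text \<open>
  The equations for a parallel diagram and a juxtaposed machine split into those of the
  two factors, so that the fixed point is the pair of the two fixed points.
\<close>

lemma act_par:
  assumes f: "admissible X X' f" and g: "admissible Y Y' g"
    and m: "m \<in> machines X" and n: "n \<in> machines Y"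
  shows "(act (tensor_obj X Y) (tensor_obj X' Y') (diagram_par f g) (juxtapose X Y m n),
    juxtapose X' Y' (act X X' f m) (act Y Y' g n)) \<in> machine_eq (tensor_obj X' Y')"
proof (rule machine_eq_of_same_states)
  note d = admissibleD(3)[OF f] admissibleD(3)[OF g]
  note fg = admissible_par[OF f g] and mn = juxtapose_machines[OF m n]
  show "act (tensor_obj X Y) (tensor_obj X' Y') (diagram_par f g) (juxtapose X Y m n)
      \<in> machines (tensor_obj X' Y')"
    by (rule act_machines[OF fg mn])
  show "juxtapose X' Y' (act X X' f m) (act Y Y' g n) \<in> machines (tensor_obj X' Y')"
    by (intro juxtapose_machines act_machines f g m n)
  fix c z
  assume "z \<in> RR (states (juxtapose X' Y' (act X X' f m) (act Y Y' g n)))"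
  then have z: "z \<in> RR (states (juxtapose X Y m n))"
    by simp
  let ?x = "pull (states m) InL z" and ?y = "pull (states n) InR z"
  define p where "p = fixpt X f (readout m) (in_map X f (pull (inp X') InL c)) ?x"
  define q where "q = fixpt Y g (readout n) (in_map Y g (pull (inp Y') InR c)) ?y"
  have p: "feedback_sol X f (readout m) (in_map X f (pull (inp X') InL c)) ?x p"
    unfolding p_def by (rule feedback_sol_fixpt[OF f m]) simp
  have q: "feedback_sol Y g (readout n) (in_map Y g (pull (inp Y') InR c)) ?y q"
    unfolding q_def by (rule feedback_sol_fixpt[OF g n]) simp
  note pq = feedback_solD(1,2)[OF p] feedback_solD(1,2)[OF q]
  let ?pq = "(join_vec (inp X) (inp Y) (fst p, fst q), join_vec (outp X) (outp Y) (snd p, snd q))"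
  have "feedback_sol (tensor_obj X Y) (diagram_par f g) (readout (juxtapose X Y m n))
      (in_map (tensor_obj X Y) (diagram_par f g) c) z ?pq"
  proof (rule feedback_solI)
    have "join_vec (inp X) (inp Y) (fst p, fst q) = join_vec (inp X) (inp Y)
      (vadd (inp X) (tr_map X f (snd p)) (in_map X f (pull (inp X') InL c)),
       vadd (inp Y) (tr_map Y g (snd q)) (in_map Y g (pull (inp Y') InR c)))"
      by (rule arg_cong[where f = "join_vec _ _"], rule arg_cong2[where f = Pair])
        (rule feedback_solD(3)[OF p], rule feedback_solD(3)[OF q])
    then show "fst ?pq = vadd (inp (tensor_obj X Y)) (tr_map (tensor_obj X Y) (diagram_par f g) (snd ?pq))
        (in_map (tensor_obj X Y) (diagram_par f g) c)"
      unfolding wire_maps_par[OF d] by (simp add: join_vadd pull_join pq)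
    have "join_vec (outp X) (outp Y) (snd p, snd q)
        = join_vec (outp X) (outp Y) (readout m (fst p, ?x), readout n (fst q, ?y))"
      by (rule arg_cong[where f = "join_vec _ _"], rule arg_cong2[where f = Pair])
        (rule feedback_solD(4)[OF p], rule feedback_solD(4)[OF q])
    then show "snd ?pq = readout (juxtapose X Y m n) (fst ?pq, z)"
      by (simp add: pull_join pq)
  qed simp_all
  then have fp: "fixpt (tensor_obj X Y) (diagram_par f g) (readout (juxtapose X Y m n))
      (in_map (tensor_obj X Y) (diagram_par f g) c) z = ?pq"
    by (rule fixpt_eq[OF fg mn z])
  show "update (act (tensor_obj X Y) (tensor_obj X' Y') (diagram_par f g) (juxtapose X Y m n)) (c, z)
      = update (juxtapose X' Y' (act X X' f m) (act Y Y' g n)) (c, z)"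
    unfolding act_sel(2) fp by (simp add: pull_join pq flip: p_def q_def)
  show "readout (act (tensor_obj X Y) (tensor_obj X' Y') (diagram_par f g) (juxtapose X Y m n)) (c, z)
      = readout (juxtapose X' Y' (act X X' f m) (act Y Y' g n)) (c, z)"
    unfolding act_sel(3) fp by (simp add: wire_maps_par[OF d] pull_join pq flip: p_def q_def)
qed simp

lemma trivial_machine_machines: "trivial_machine \<in> machines unit_obj"
  by (rule machinesI) (auto simp: trivial_machine_def RR_def)

text \<open>
  The two bracketings have different state sets. They are identified by the same reassociation of
  disjoint unions that relabels the ports; likewise for the unit laws below, where the
  state set of one factor is empty.
\<close>

lemma act_assoc:
  assumes ob: "is_diface X" "is_diface Y" "is_diface Z"
    and m: "l \<in> machines X" "m \<in> machines Y" "n \<in> machines Z"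
  shows "(act (tensor_obj (tensor_obj X Y) Z) (tensor_obj X (tensor_obj Y Z))
      (relabel (tensor_obj (tensor_obj X Y) Z) assoc_fun)
      (juxtapose (tensor_obj X Y) Z (juxtapose X Y l m) n),
    juxtapose X (tensor_obj Y Z) l (juxtapose Y Z m n)) \<in> machine_eq (tensor_obj X (tensor_obj Y Z))"
proof -
  note iso = port_iso_assoc[OF ob]
  note left = juxtapose_machines[OF juxtapose_machines[OF m(1,2)] m(3)]
  note right = juxtapose_machines[OF m(1) juxtapose_machines[OF m(2,3)]]
  have bij: "bij_betw assoc_fun (dunion (dunion A B) C) (dunion A (dunion B C))"
    for A B C :: "'a univ set"
    by (rule bij_betw_byWitness[where f' = assoc_inv]) (auto elim!: dunionE)
  show ?thesis
    by (rule machine_eqI[OF act_machines[OF admissible_relabel[OF port_iso_preserves_dep[OF iso]] left] right,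
          of assoc_fun])
      (simp_all add: bij act_relabel[OF iso left] join_assoc split_assoc_fun del: act_sel(2,3))
qed

lemma act_lunit:
  assumes ob: "is_diface X" and m: "m \<in> machines X"
  shows "(act (tensor_obj unit_obj X) X (relabel (tensor_obj unit_obj X) (copair id id))
    (juxtapose unit_obj X trivial_machine m), m) \<in> machine_eq X"
proof -
  note iso = port_iso_lunit[OF ob]
  note left = juxtapose_machines[OF trivial_machine_machines m]
  have triv: "states trivial_machine = {}"
    by (simp add: trivial_machine_def)
  have bij: "bij_betw (copair id id) (dunion {} A) A" for A :: "'a univ set"
    by (rule bij_betw_byWitness[where f' = InR]) (auto elim!: dunionE)
  show ?thesis
    by (rule machine_eqI[OF act_machines[OF admissible_relabel[OF port_iso_preserves_dep[OF iso]] left] m,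
          of "copair id id"])
      (simp_all add: triv bij act_relabel[OF iso left, unfolded juxtapose_sel triv] join_empty(1)
        split_codiagonal machinesD[OF m] del: act_sel(2,3))
qed

lemma act_runit:
  assumes ob: "is_diface X" and m: "m \<in> machines X"
  shows "(act (tensor_obj X unit_obj) X (relabel (tensor_obj X unit_obj) (copair id id))
    (juxtapose X unit_obj m trivial_machine), m) \<in> machine_eq X"
proof -
  note iso = port_iso_runit[OF ob]
  note left = juxtapose_machines[OF m trivial_machine_machines]
  have triv: "states trivial_machine = {}"
    by (simp add: trivial_machine_def)
  have bij: "bij_betw (copair id id) (dunion A {}) A" for A :: "'a univ set"
    by (rule bij_betw_byWitness[where f' = InL]) (auto elim!: dunionE)
  show ?thesis
    by (rule machine_eqI[OF act_machines[OF admissible_relabel[OF port_iso_preserves_dep[OF iso]] left] m,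
          of "copair id id"])
      (simp_all add: triv bij act_relabel[OF iso left, unfolded juxtapose_sel triv] join_empty(2)
        split_codiagonal machinesD[OF m] del: act_sel(2,3))
qed

lemma act_id:
  assumes ob: "is_diface X" and m: "m \<in> machines X"
  shows "(act X X (relabel X id) m, m) \<in> machine_eq X"
proof -
  have iso: "port_iso X X id id"
    using ob by (simp add: port_iso_def preserves_dep_id)
  show ?thesis
    by (rule machine_eq_of_same_states[OF act_machines[OF admissible_relabel[OF port_iso_preserves_dep[OF iso]] m] m])
      (simp_all add: act_relabel[OF iso m] pull_id machinesD[OF m] del: act_sel(2,3))
qed

section \<open>The lax monoidal functor\<close>

theorem theorem3p4:
  shows "lax_monoidal_functor_to_Set (dDWD :: ('a univ diface, 'a wmor) moncat)
    Mealy Mealy_map Mealy_laxator Mealy_unit"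
proof (rule lax_monoidal_functor_to_Set.intro[OF monoidal_category_dDWD], unfold_locales)
  fix f :: "'a wmor" and X Y
  assume "f \<in> Hom dDWD X Y"
  then show "Mealy_map f \<in> Mealy X \<rightarrow> Mealy Y"
    by (auto simp: Hom_dDWD_iff Mealy_map_mor elim!: MealyE intro!: machine_class_Mealy act_machines)
next
  fix X :: "'a univ diface" and M
  assume X: "X \<in> Ob dDWD" and "M \<in> Mealy X"
  then obtain m where m: "m \<in> machines X" "M = machine_class X m"
    by (auto elim!: MealyE)
  with X show "Mealy_map (Idt dDWD X) M = M"
    by (simp add: dDWD_structure Mealy_map_mor admissible_relabel preserves_dep_id machine_class_eq[OF act_id])
next
  fix F G :: "'a wmor" and X Y Z M
  assume "F \<in> Hom dDWD X Y" "G \<in> Hom dDWD Y Z" "M \<in> Mealy X"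
  then obtain f g m where f: "admissible X Y f" "F = mor X Y f" and g: "admissible Y Z g" "G = mor Y Z g"
    and m: "m \<in> machines X" "M = machine_class X m"
    by (auto simp: Hom_dDWD_iff elim!: MealyE)
  have GF: "Comp dDWD G F = mor X Z (diagram_comp g f)"
    by (simp add: f g wcomp_mor[OF admissibleD(3)[OF f(1)] admissibleD(3)[OF g(1)]])
  show "Mealy_map (Comp dDWD G F) M = Mealy_map G (Mealy_map F M)"
    unfolding GF m(2) Mealy_map_mor[OF admissible_comp[OF f(1) g(1)] m(1)]
    by (simp add: f g m Mealy_map_mor act_machines machine_class_eq[OF act_comp])
next
  fix X Y :: "'a univ diface"
  show "Mealy_laxator X Y \<in> Mealy X \<times> Mealy Y \<rightarrow> Mealy (TenO dDWD X Y)"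
    by (auto simp: Mealy_laxator_class elim!: MealyE intro!: machine_class_Mealy[of _ "tensor_obj X Y"] juxtapose_machines)
next
  fix F G :: "'a wmor" and X X' Y Y' M N
  assume "F \<in> Hom dDWD X X'" "G \<in> Hom dDWD Y Y'" "M \<in> Mealy X" "N \<in> Mealy Y"
  then obtain f g m n where f: "admissible X X' f" "F = mor X X' f" and g: "admissible Y Y' g" "G = mor Y Y' g"
    and m: "m \<in> machines X" "M = machine_class X m" and n: "n \<in> machines Y" "N = machine_class Y n"
    by (auto simp: Hom_dDWD_iff elim!: MealyE)
  have FG: "TenA dDWD (mor X X' f) (mor Y Y' g) = mor (tensor_obj X Y) (tensor_obj X' Y') (diagram_par f g)"
    by (simp add: tensor_mor_mor[OF admissibleD(3)[OF f(1)] admissibleD(3)[OF g(1)]])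
  show "Mealy_map (TenA dDWD F G) (Mealy_laxator X Y (M, N))
      = Mealy_laxator X' Y' (Mealy_map F M, Mealy_map G N)"
    unfolding FG m(2) n(2) f(2) g(2) Mealy_laxator_class[OF m(1) n(1)]
      Mealy_map_mor[OF f(1) m(1)] Mealy_map_mor[OF g(1) n(1)]
      Mealy_laxator_class[OF act_machines[OF f(1) m(1)] act_machines[OF g(1) n(1)]]
      Mealy_map_mor[OF admissible_par[OF f(1) g(1)] juxtapose_machines[OF m(1) n(1)]]
    by (rule machine_class_eq[OF act_par[OF f(1) g(1) m(1) n(1)]])
next
  show "Mealy_unit \<in> {()} \<rightarrow> Mealy (Unit (dDWD :: ('a univ diface, 'a wmor) moncat))"
    by (auto simp: Mealy_unit_def intro!: machine_class_Mealy trivial_machine_machines)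
next
  fix X Y Z :: "'a univ diface" and L M N
  assume ob: "X \<in> Ob dDWD" "Y \<in> Ob dDWD" "Z \<in> Ob dDWD"
    and "L \<in> Mealy X" "M \<in> Mealy Y" "N \<in> Mealy Z"
  then obtain l m n where l: "l \<in> machines X" "L = machine_class X l"
    and m: "m \<in> machines Y" "M = machine_class Y m" and n: "n \<in> machines Z" "N = machine_class Z n"
    by (auto elim!: MealyE)
  from ob have adm: "admissible (tensor_obj (tensor_obj X Y) Z) (tensor_obj X (tensor_obj Y Z))
      (relabel (tensor_obj (tensor_obj X Y) Z) assoc_fun)"
    by (simp add: admissible_relabel port_iso_preserves_dep[OF port_iso_assoc])
  show "Mealy_map (Assoc dDWD X Y Z) (Mealy_laxator (TenO dDWD X Y) Z (Mealy_laxator X Y (L, M), N))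
      = Mealy_laxator X (TenO dDWD Y Z) (L, Mealy_laxator Y Z (M, N))"
    using ob by (simp add: l m n Mealy_laxator_class juxtapose_machines dDWD_structure
        Mealy_map_mor[OF adm] machine_class_eq[OF act_assoc])
next
  fix X :: "'a univ diface" and M
  assume ob: "X \<in> Ob dDWD" and "M \<in> Mealy X"
  then obtain m where m: "m \<in> machines X" "M = machine_class X m"
    by (auto elim!: MealyE)
  from ob have adm: "admissible (tensor_obj unit_obj X) X (relabel (tensor_obj unit_obj X) (copair id id))"
      "admissible (tensor_obj X unit_obj) X (relabel (tensor_obj X unit_obj) (copair id id))"
    by (simp_all add: admissible_relabel port_iso_preserves_dep[OF port_iso_lunit] port_iso_preserves_dep[OF port_iso_runit])
  show "Mealy_map (Lunit dDWD X) (Mealy_laxator (Unit dDWD) X (Mealy_unit (), M)) = M"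
    using ob by (simp add: m Mealy_unit_def Mealy_laxator_class trivial_machine_machines juxtapose_machines
        dDWD_structure Mealy_map_mor[OF adm(1)] machine_class_eq[OF act_lunit])
  show "Mealy_map (Runit dDWD X) (Mealy_laxator X (Unit dDWD) (M, Mealy_unit ())) = M"
    using ob by (simp add: m Mealy_unit_def Mealy_laxator_class trivial_machine_machines juxtapose_machines
        dDWD_structure Mealy_map_mor[OF adm(2)] machine_class_eq[OF act_runit])
qed

end
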